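(* Let $(M,g)$ be a Riemannian manifold of dimension $m$ and let $(g,u,f,\sigma)$ be a gradient almost $(RH)_\alpha$ soliton on $M$. Then the following equations hold on $M$: $$\mathrm{div}\,Sc=\tfrac12\nabla S-\alpha\,\tau_g(u)\nabla u,$$ $$\langle\nabla S,\nabla f\rangle=2(m-1)\langle\nabla\sigma,\nabla f\rangle+2\,Sc(\nabla f,\nabla f),$$ $$Sc(\nabla f,\cdot)=\tfrac12\nabla S-(m-1)\nabla\sigma,$$ $$\nabla\big(S+|\nabla f|^2\big)=2(m-1)\nabla\sigma+2\sigma\nabla f,$$ $$\tfrac12\Delta|\nabla f|^2=|\mathrm{Hess} f|^2-(m-2)\langle\nabla\sigma,\nabla f\rangle-Sc(\nabla f,\nabla f)+\alpha\,|\langle\nabla u,\nabla f\rangle|^2.$$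
   Context: Let $(M,g)$ and $(N,h)$ be Riemannian manifolds, $m=\dim M$, and let $\alpha>0$ be a constant. A gradient almost $(RH)_\alpha$ soliton (gradient almost Ricci-harmonic soliton) is a quadruple $(g,u,f,\sigma)$ with $u:(M,g)\to(N,h)$ a smooth map and $f,\sigma:M\to\mathbb{R}$ smooth functions satisfying $$Rc-\alpha\,\nabla u\otimes\nabla u+\mathrm{Hess} f=\sigma g,\qquad \tau_g u-\langle\nabla u,\nabla f\rangle=0,$$ where $Rc$ is the Ricci tensor of $g$, $\nabla u\otimes\nabla u=u^*h$ is the pullback metric, $\tau_g u=\mathrm{trace}_g\nabla du$ is the tension field of $u$ (a section of $u^*TN$), and $\langle\nabla u,\nabla f\rangle=du(\nabla f)$, with $|\langle\nabla u,\nabla f\rangle|^2=(u^*h)(\nabla f,\nabla f)$. Write $|\nabla u|^2=\mathrm{trace}_g(u^*h)$, let $R$ be the scalar curvature of $g$, and set $Sc:=Rc-\alpha\,\nabla u\otimes\nabla u$ and $S:=\mathrm{trace}_g Sc=R-\alpha|\nabla u|^2$. The divergence is $(\mathrm{div}\,Sc)_k=g^{ij}\nabla_iS_{jk}$; $\tau_g(u)\nabla u$ denotes the one-form $X\mapsto h(\tau_g u,du(X))$; vector fields and one-forms are identified via $g$. $\Delta$ is the Laplace–Beltrami operator (trace of the Hessian). *)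

theory Defs
  imports "HOL-Analysis.Analysis"
begin

section \<open>Smooth functions on open subsets of Euclidean space\<close>

definition partial :: "'m::finite \<Rightarrow> (real^'m \<Rightarrow> real) \<Rightarrow> real^'m \<Rightarrow> real" where
  "partial i F x = frechet_derivative F (at x) (axis i 1)"

primrec Ck_on :: "nat \<Rightarrow> (real^'m::finite) set \<Rightarrow> (real^'m \<Rightarrow> real) \<Rightarrow> bool" where
  "Ck_on 0 W F \<longleftrightarrow> continuous_on W F"
| "Ck_on (Suc k) W F \<longleftrightarrow>
     (\<forall>x\<in>W. F differentiable (at x)) \<and> (\<forall>i. Ck_on k W (partial i F))"

text \<open>Only used for open \<open>W\<close>, where the derivatives depend on the values on \<open>W\<close> alone.\<close>

definition smooth_on :: "(real^'m::finite) set \<Rightarrow> (real^'m \<Rightarrow> real) \<Rightarrow> bool" where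
  "smooth_on W F \<longleftrightarrow> (\<forall>k. Ck_on k W F)"


section \<open>Smooth manifolds and smooth maps\<close>

text \<open>
  The manifold is the whole type \<open>'a\<close>; it will be of sort
  \<open>{t2_space, second_countable_topology}\<close>. A chart is a pair of a domain and a coordinate map,
  whose values off the domain are irrelevant. The dimension is \<open>CARD('m)\<close>.
\<close>

type_synonym ('a, 'm) chart = "'a set \<times> ('a \<Rightarrow> real^'m)"

abbreviation chart_dom :: "('a, 'm) chart \<Rightarrow> 'a set" where
  "chart_dom c \<equiv> fst c"

abbreviation chart_map :: "('a, 'm) chart \<Rightarrow> 'a \<Rightarrow> real^'m" where
  "chart_map c \<equiv> snd c"

definition chart_img :: "('a, 'm) chart \<Rightarrow> (real^'m) set" where
  "chart_img c = chart_map c ` chart_dom c"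

definition chart_inv :: "('a, 'm) chart \<Rightarrow> real^'m \<Rightarrow> 'a" where
  "chart_inv c = inv_into (chart_dom c) (chart_map c)"

definition is_chart :: "('a::topological_space, 'm::finite) chart \<Rightarrow> bool" where
  "is_chart c \<longleftrightarrow> open (chart_dom c) \<and> open (chart_img c) \<and>
     homeomorphism (chart_dom c) (chart_img c) (chart_map c) (chart_inv c)"

text \<open>The atlas is arbitrary, in particular it is not required to be maximal.\<close>

definition smooth_atlas :: "('a::topological_space, 'm::finite) chart set \<Rightarrow> bool" where
  "smooth_atlas A \<longleftrightarrow> (\<forall>c\<in>A. is_chart c) \<and> (\<Union>c\<in>A. chart_dom c) = UNIV \<and>
     (\<forall>c\<in>A. \<forall>d\<in>A. \<forall>i. smooth_on (chart_map c ` (chart_dom c \<inter> chart_dom d))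
                              (\<lambda>x. chart_map d (chart_inv c x) $ i))"

definition smooth_fun_on ::
    "('a::topological_space, 'm::finite) chart set \<Rightarrow> 'a set \<Rightarrow> ('a \<Rightarrow> real) \<Rightarrow> bool" where
  "smooth_fun_on A W F \<longleftrightarrow>
     (\<forall>c\<in>A. smooth_on (chart_map c ` (chart_dom c \<inter> W)) (F \<circ> chart_inv c))"

definition smooth_near ::
    "('a::topological_space, 'm::finite) chart set \<Rightarrow> 'a \<Rightarrow> ('a \<Rightarrow> real) \<Rightarrow> bool" where
  "smooth_near A p F \<longleftrightarrow> (\<exists>W. open W \<and> p \<in> W \<and> smooth_fun_on A W F)"

definition smooth_map ::
    "('a::topological_space, 'm::finite) chart set \<Rightarrow> ('b::topological_space, 'n::finite) chart set
      \<Rightarrow> ('a \<Rightarrow> 'b) \<Rightarrow> bool" where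
  "smooth_map A B u \<longleftrightarrow> continuous_on UNIV u \<and>
     (\<forall>c\<in>A. \<forall>d\<in>B. \<forall>i. smooth_on (chart_map c ` (chart_dom c \<inter> u -` chart_dom d))
                              (\<lambda>x. chart_map d (u (chart_inv c x)) $ i))"


section \<open>Tangent vectors and Riemannian metrics\<close>

text \<open>
  Tangent vectors at \<open>p\<close> are the derivations of the functions that are smooth near \<open>p\<close>. As
  functionals on all functions they are normalised to vanish on the other ones. That they only
  depend on germs at \<open>p\<close> follows from the Leibniz rule, because the indicator function of an open
  neighbourhood of \<open>p\<close> is smooth near \<open>p\<close>.
\<close>

type_synonym 'a tvec = "('a \<Rightarrow> real) \<Rightarrow> real"

definition tangent_space ::
    "('a::topological_space, 'm::finite) chart set \<Rightarrow> 'a \<Rightarrow> 'a tvec set" where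
  "tangent_space A p = {X.
     (\<forall>F. \<not> smooth_near A p F \<longrightarrow> X F = 0) \<and>
     (\<forall>F H. smooth_near A p F \<longrightarrow> smooth_near A p H \<longrightarrow>
        (\<forall>a b. X (\<lambda>q. a * F q + b * H q) = a * X F + b * X H) \<and>
        X (\<lambda>q. F q * H q) = F p * X H + H p * X F)}"

definition coord_vec ::
    "('a::topological_space, 'm::finite) chart set \<Rightarrow> ('a, 'm) chart \<Rightarrow> 'a \<Rightarrow> 'm \<Rightarrow> 'a tvec" where
  "coord_vec A c p i F =
     (if smooth_near A p F then partial i (F \<circ> chart_inv c) (chart_map c p) else 0)"

text \<open>The tangent vector with components \<open>v\<close> in the chart \<open>c\<close>.\<close>

definition vec_of ::
    "('a::topological_space, 'm::finite) chart set \<Rightarrow> ('a, 'm) chart \<Rightarrow> 'a \<Rightarrow> real^'m \<Rightarrow> 'a tvec" where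
  "vec_of A c p v F = (\<Sum>i\<in>UNIV. v $ i * coord_vec A c p i F)"

definition differential ::
    "('b::topological_space, 'n::finite) chart set \<Rightarrow> ('a \<Rightarrow> 'b) \<Rightarrow> 'a \<Rightarrow> 'a tvec \<Rightarrow> 'b tvec" where
  "differential B u p X F = (if smooth_near B (u p) F then X (F \<circ> u) else 0)"

text \<open>A covariant 2-tensor field; its values matter on tangent vectors only.\<close>

type_synonym 'a tensor2 = "'a \<Rightarrow> 'a tvec \<Rightarrow> 'a tvec \<Rightarrow> real"

definition tensor_components ::
    "('a::topological_space, 'm::finite) chart set \<Rightarrow> 'a tensor2 \<Rightarrow> ('a, 'm) chart
      \<Rightarrow> real^'m \<Rightarrow> real^'m^'m" where
  "tensor_components A T c x = (\<chi> i j. T (chart_inv c x)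
     (coord_vec A c (chart_inv c x) i) (coord_vec A c (chart_inv c x) j))"

definition riemannian_metric ::
    "('a::topological_space, 'm::finite) chart set \<Rightarrow> 'a tensor2 \<Rightarrow> bool" where
  "riemannian_metric A g \<longleftrightarrow>
     (\<forall>p. \<forall>X\<in>tangent_space A p. \<forall>Y\<in>tangent_space A p. \<forall>Z\<in>tangent_space A p.
        (\<forall>a b. g p (\<lambda>F. a * X F + b * Y F) Z = a * g p X Z + b * g p Y Z) \<and>
        g p X Y = g p Y X \<and> (X \<noteq> (\<lambda>F. 0) \<longrightarrow> g p X X > 0)) \<and>
     (\<forall>c\<in>A. \<forall>i j. smooth_on (chart_img c) (\<lambda>x. tensor_components A g c x $ i $ j))"

definition riemannian_manifold ::
    "('a::{t2_space, second_countable_topology}, 'm::finite) chart set \<Rightarrow> 'a tensor2 \<Rightarrow> bool" where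
  "riemannian_manifold A g \<longleftrightarrow> smooth_atlas A \<and> riemannian_metric A g"

definition pullback ::
    "('b::topological_space, 'n::finite) chart set \<Rightarrow> 'b tensor2 \<Rightarrow> ('a \<Rightarrow> 'b) \<Rightarrow> 'a tensor2" where
  "pullback B h u p X Y = h (u p) (differential B u p X) (differential B u p Y)"


section \<open>Riemannian geometry in local coordinates\<close>

text \<open>
  Throughout, \<open>G\<close> is the matrix of components of the metric as a function of the coordinates, and
  functions and tensors are given by their local representations. Each operation is tensorial, so
  the objects defined here are the components, in the chart at hand, of global ones.
\<close>

type_synonym 'm field2 = "real^'m \<Rightarrow> real^'m^'m"

definition ginv :: "'m::finite field2 \<Rightarrow> 'm field2" where
  "ginv G x = matrix_inv (G x)"

text \<open>\<open>christoffel G k i j\<close> is \<open>\<Gamma>\<^sup>k\<^sub>i\<^sub>j\<close>, for the Levi-Civita connection.\<close>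

definition christoffel :: "'m::finite field2 \<Rightarrow> 'm \<Rightarrow> 'm \<Rightarrow> 'm \<Rightarrow> real^'m \<Rightarrow> real" where
  "christoffel G k i j x = 1/2 * (\<Sum>l\<in>UNIV. ginv G x $ k $ l *
     (partial i (\<lambda>y. G y $ j $ l) x + partial j (\<lambda>y. G y $ i $ l) x - partial l (\<lambda>y. G y $ i $ j) x))"

text \<open>
  \<open>curvature G i j k l\<close> is the \<open>l\<close>-th component of
  \<open>R(\<partial>\<^sub>i, \<partial>\<^sub>j)\<partial>\<^sub>k = \<nabla>\<^sub>i\<nabla>\<^sub>j\<partial>\<^sub>k - \<nabla>\<^sub>j\<nabla>\<^sub>i\<partial>\<^sub>k\<close>, and the Ricci tensor is
  \<open>Rc(Y, Z) = trace (X \<mapsto> R(X, Y)Z)\<close>, which is positive on round spheres.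
\<close>

definition curvature :: "'m::finite field2 \<Rightarrow> 'm \<Rightarrow> 'm \<Rightarrow> 'm \<Rightarrow> 'm \<Rightarrow> real^'m \<Rightarrow> real" where
  "curvature G i j k l x =
     partial i (christoffel G l j k) x - partial j (christoffel G l i k) x
     + (\<Sum>p\<in>UNIV. christoffel G p j k x * christoffel G l i p x
               - christoffel G p i k x * christoffel G l j p x)"

definition ricci :: "'m::finite field2 \<Rightarrow> 'm field2" where
  "ricci G x = (\<chi> j k. \<Sum>i\<in>UNIV. curvature G i j k i x)"

definition apply2 :: "real^'m::finite^'m \<Rightarrow> real^'m \<Rightarrow> real^'m \<Rightarrow> real" where
  "apply2 T v w = (\<Sum>i\<in>UNIV. \<Sum>j\<in>UNIV. T $ i $ j * v $ i * w $ j)"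

definition trace2 :: "'m::finite field2 \<Rightarrow> 'm field2 \<Rightarrow> real^'m \<Rightarrow> real" where
  "trace2 G T x = (\<Sum>i\<in>UNIV. \<Sum>j\<in>UNIV. ginv G x $ i $ j * T x $ i $ j)"

definition norm2_squared :: "'m::finite field2 \<Rightarrow> 'm field2 \<Rightarrow> real^'m \<Rightarrow> real" where
  "norm2_squared G T x = (\<Sum>i\<in>UNIV. \<Sum>j\<in>UNIV. \<Sum>k\<in>UNIV. \<Sum>l\<in>UNIV.
     ginv G x $ i $ k * ginv G x $ j $ l * T x $ i $ j * T x $ k $ l)"

text \<open>\<open>nabla2 G T i j k\<close> is \<open>\<nabla>\<^sub>i T\<^sub>j\<^sub>k\<close>.\<close>

definition nabla2 :: "'m::finite field2 \<Rightarrow> 'm field2 \<Rightarrow> 'm \<Rightarrow> 'm \<Rightarrow> 'm \<Rightarrow> real^'m \<Rightarrow> real" where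
  "nabla2 G T i j k x = partial i (\<lambda>y. T y $ j $ k) x
     - (\<Sum>p\<in>UNIV. christoffel G p i j x * T x $ p $ k)
     - (\<Sum>p\<in>UNIV. christoffel G p i k x * T x $ j $ p)"

definition divergence2 :: "'m::finite field2 \<Rightarrow> 'm field2 \<Rightarrow> 'm \<Rightarrow> real^'m \<Rightarrow> real" where
  "divergence2 G T k x = (\<Sum>i\<in>UNIV. \<Sum>j\<in>UNIV. ginv G x $ i $ j * nabla2 G T i j k x)"

definition gradient :: "'m::finite field2 \<Rightarrow> (real^'m \<Rightarrow> real) \<Rightarrow> real^'m \<Rightarrow> real^'m" where
  "gradient G F x = (\<chi> i. \<Sum>j\<in>UNIV. ginv G x $ i $ j * partial j F x)"

definition hessian :: "'m::finite field2 \<Rightarrow> (real^'m \<Rightarrow> real) \<Rightarrow> 'm field2" where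
  "hessian G F x = (\<chi> i j. partial i (partial j F) x
     - (\<Sum>k\<in>UNIV. christoffel G k i j x * partial k F x))"

definition laplacian :: "'m::finite field2 \<Rightarrow> (real^'m \<Rightarrow> real) \<Rightarrow> real^'m \<Rightarrow> real" where
  "laplacian G F = trace2 G (hessian G F)"

text \<open>
  For a map with local representation \<open>U\<close> into a manifold with metric components \<open>H\<close>,
  \<open>nabla_du G H U a i j\<close> is the component \<open>(\<nabla>du)\<^sup>a\<^sub>i\<^sub>j\<close>.
\<close>

definition nabla_du ::
    "'m::finite field2 \<Rightarrow> 'n::finite field2 \<Rightarrow> (real^'m \<Rightarrow> real^'n) \<Rightarrow> 'n \<Rightarrow> 'm \<Rightarrow> 'm \<Rightarrow> real^'m \<Rightarrow> real" where
  "nabla_du G H U a i j x = partial i (partial j (\<lambda>y. U y $ a)) x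
     - (\<Sum>k\<in>UNIV. christoffel G k i j x * partial k (\<lambda>y. U y $ a) x)
     + (\<Sum>b\<in>UNIV. \<Sum>e\<in>UNIV. christoffel H a b e (U x)
          * partial i (\<lambda>y. U y $ b) x * partial j (\<lambda>y. U y $ e) x)"

definition tension_comp ::
    "'m::finite field2 \<Rightarrow> 'n::finite field2 \<Rightarrow> (real^'m \<Rightarrow> real^'n) \<Rightarrow> real^'m \<Rightarrow> real^'n" where
  "tension_comp G H U x =
     (\<chi> a. \<Sum>i\<in>UNIV. \<Sum>j\<in>UNIV. ginv G x $ i $ j * nabla_du G H U a i j x)"


section \<open>Gradient almost Ricci-harmonic solitons\<close>

text \<open>
  The tension field at the point with coordinates \<open>x\<close> in the chart \<open>c\<close> of the source, computed
  with a chart \<open>d\<close> of the target around the image of that point, as a tangent vector of the target.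
\<close>

definition tension ::
    "('a::topological_space, 'm::finite) chart set \<Rightarrow> 'a tensor2
      \<Rightarrow> ('b::topological_space, 'n::finite) chart set \<Rightarrow> 'b tensor2 \<Rightarrow> ('a \<Rightarrow> 'b)
      \<Rightarrow> ('a, 'm) chart \<Rightarrow> ('b, 'n) chart \<Rightarrow> real^'m \<Rightarrow> 'b tvec" where
  "tension A g B h u c d x = vec_of B d (u (chart_inv c x))
     (tension_comp (tensor_components A g c) (tensor_components B h d) (chart_map d \<circ> u \<circ> chart_inv c) x)"

definition grad_vec ::
    "('a::topological_space, 'm::finite) chart set \<Rightarrow> 'a tensor2 \<Rightarrow> ('a \<Rightarrow> real)
      \<Rightarrow> ('a, 'm) chart \<Rightarrow> real^'m \<Rightarrow> 'a tvec" where
  "grad_vec A g f c x =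
     vec_of A c (chart_inv c x) (gradient (tensor_components A g c) (f \<circ> chart_inv c) x)"

definition Sc_tensor ::
    "real \<Rightarrow> ('a::topological_space, 'm::finite) chart set \<Rightarrow> 'a tensor2
      \<Rightarrow> ('b::topological_space, 'n::finite) chart set \<Rightarrow> 'b tensor2 \<Rightarrow> ('a \<Rightarrow> 'b)
      \<Rightarrow> ('a, 'm) chart \<Rightarrow> 'm field2" where
  "Sc_tensor \<alpha> A g B h u c x =
     ricci (tensor_components A g c) x - \<alpha> *\<^sub>R tensor_components A (pullback B h u) c x"

definition gradient_almost_RH_soliton ::
    "real \<Rightarrow> ('a::topological_space, 'm::finite) chart set
      \<Rightarrow> ('b::topological_space, 'n::finite) chart set \<Rightarrow> 'b tensor2
      \<Rightarrow> 'a tensor2 \<Rightarrow> ('a \<Rightarrow> 'b) \<Rightarrow> ('a \<Rightarrow> real) \<Rightarrow> ('a \<Rightarrow> real) \<Rightarrow> bool" where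
  "gradient_almost_RH_soliton \<alpha> A B h g u f \<sigma> \<longleftrightarrow>
     smooth_map A B u \<and> smooth_fun_on A UNIV f \<and> smooth_fun_on A UNIV \<sigma> \<and>
     (\<forall>c\<in>A. \<forall>x\<in>chart_img c.
        Sc_tensor \<alpha> A g B h u c x + hessian (tensor_components A g c) (f \<circ> chart_inv c) x
          = \<sigma> (chart_inv c x) *\<^sub>R tensor_components A g c x \<and>
        (\<forall>d\<in>B. u (chart_inv c x) \<in> chart_dom d \<longrightarrow>
           (\<forall>F. tension A g B h u c d x F
                - differential B u (chart_inv c x) (grad_vec A g f c x) F = 0)))"

end

theory Submission
  imports Defs
begin

text \<open>
  Contracting the second Bianchi identity gives \<open>div Rc = \<nabla>R / 2\<close>, and for the pullback metric
  \<open>div (u\<^sup>* h) = h(\<tau>, du) + \<nabla>|\<nabla>u|\<^sup>2 / 2\<close>; together they are the first equation. Taking the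
  divergence of the soliton equation, with \<open>div (Hess f) = \<nabla>\<Delta>f + Rc(\<nabla>f, \<cdot>)\<close>, with \<open>\<Delta>f = m \<sigma> - S\<close>
  from its trace, and with \<open>\<tau> = du(\<nabla>f)\<close>, gives the third equation. The second and the fourth follow from
  it, using \<open>\<nabla>|\<nabla>f|\<^sup>2 = 2 Hess f(\<nabla>f, \<cdot>)\<close>, and the last one from the Bochner formula
  \<open>\<Delta>|\<nabla>f|\<^sup>2 / 2 = |Hess f|\<^sup>2 + div (Hess f)(\<nabla>f)\<close>.
\<close>

section \<open>Calculus of smooth functions\<close>

text \<open>The theorem concerns components at one point of one chart, so each tensor identity is
  checked with Christoffel symbols at an arbitrary point of an open set \<open>W\<close> of
  coordinates. Two devices keep this tractable. The Christoffel symbols are grouped into connection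
  matrices A_i with curvature dA + [A, A], which turns the Bianchi identity and the skewness of the
  curvature into matrix algebra over commuting partial derivatives; and
  \<open>partial_contract\<close> turns the derivative of a contraction into the contraction of
  covariant derivatives. The tension field needs components in the target as well, hence
  \<open>W\<close> is the part of a source chart that \<open>u\<close> maps into a single target
  chart. The remaining obstacle is that tangent vectors are derivations with the default value 0 on
  functions that are not smooth: passing to components requires \<open>vec_of\<close> to be
  injective and \<open>u\<close> to pull smooth functions back to smooth ones.\<close>

lemma partialI: "(F has_derivative D) (at x) \<Longrightarrow> partial i F x = D (axis i 1)"
  unfolding partial_def using frechet_derivative_at by metis

lemma sum_axis: "(\<Sum>a\<in>UNIV. c a *\<^sub>R axis a (1::real)) = (\<chi> a. c a)"
  by (simp add: vec_eq_iff axis_def if_distrib cong: if_cong)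

lemma sum_axis_component: "(\<Sum>i\<in>UNIV. axis k (1::real) $ i * c i) = c k"
  by (simp add: axis_def if_distrib if_distribR cong: if_cong)

lemma has_derivative_partial:
  fixes F :: "real^'m::finite \<Rightarrow> real"
  assumes "F differentiable (at x)"
  shows "(F has_derivative (\<lambda>v. \<Sum>i\<in>UNIV. v $ i * partial i F x)) (at x)"
proof -
  let ?D = "frechet_derivative F (at x)"
  have D: "(F has_derivative ?D) (at x)"
    using assms frechet_derivative_works by blast
  then interpret linear ?D by (rule has_derivative_linear)
  have "?D v = (\<Sum>i\<in>UNIV. v $ i * partial i F x)" for v
  proof -
    have "?D v = ?D (\<Sum>i\<in>UNIV. v $ i *\<^sub>R axis i 1)"
      by (simp add: sum_axis)
    then show ?thesis by (simp only: sum scale partial_def real_scaleR_def)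
  qed
  then have "?D = (\<lambda>v. \<Sum>i\<in>UNIV. v $ i * partial i F x)" by (rule ext)
  from D[unfolded this] show ?thesis .
qed

text \<open>Derivatives are local. This is what allows differentiating identities that hold only on
  the coordinate region, such as symmetry of the metric or the soliton equation.\<close>

lemma partial_cong:
  assumes "open W" "x \<in> W" "\<And>y. y \<in> W \<Longrightarrow> F y = H y"
  shows "partial i F x = partial i H x"
proof -
  have "(F has_derivative D) (at x) \<longleftrightarrow> (H has_derivative D) (at x)" for D
    using assms has_derivative_transform_within_open[of F D x UNIV W H]
      has_derivative_transform_within_open[of H D x UNIV W F] by auto
  then show ?thesis unfolding partial_def frechet_derivative_def by simp
qed

lemma differentiable_cong:
  assumes "open W" "x \<in> W" "\<And>y. y \<in> W \<Longrightarrow> F y = H y"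
  shows "F differentiable (at x) \<longleftrightarrow> H differentiable (at x)"
  using assms has_derivative_transform_within_open[of F _ x UNIV W H]
      has_derivative_transform_within_open[of H _ x UNIV W F]
  unfolding differentiable_def by (metis)

lemma partial_const [simp]: "partial i (\<lambda>x. c) x = 0"
  by (rule partialI[THEN trans, of _ "\<lambda>_. 0"]) auto

lemma partial_component [simp]: "partial i (\<lambda>x. x $ j) x = (if i = j then 1 else 0)"
  by (subst partialI[of _ "\<lambda>x. x $ j"])
    (auto intro!: derivative_eq_intros bounded_linear_imp_has_derivative bounded_linear_vec_nth
      simp: axis_def)

lemma frechet_derivative_worksI:
  "F differentiable net \<Longrightarrow> (F has_derivative frechet_derivative F net) net"
  using frechet_derivative_works by blast

lemma partial_add:
  assumes "F differentiable (at x)" "H differentiable (at x)"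
  shows "partial i (\<lambda>y. F y + H y) x = partial i F x + partial i H x"
  unfolding partialI[OF has_derivative_add[OF frechet_derivative_worksI frechet_derivative_worksI, OF assms]]
  by (simp add: partial_def)

lemma partial_diff:
  assumes "F differentiable (at x)" "H differentiable (at x)"
  shows "partial i (\<lambda>y. F y - H y) x = partial i F x - partial i H x"
  unfolding partialI[OF has_derivative_diff[OF frechet_derivative_worksI frechet_derivative_worksI, OF assms]]
  by (simp add: partial_def)

lemma partial_mult:
  assumes "F differentiable (at x)" "H differentiable (at x)"
  shows "partial i (\<lambda>y. F y * H y) x = partial i F x * H x + F x * partial i H x"
  unfolding partialI[OF has_derivative_mult[OF frechet_derivative_worksI frechet_derivative_worksI, OF assms]]
  by (simp add: partial_def)

lemma partial_cmult:
  assumes "F differentiable (at x)"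
  shows "partial i (\<lambda>y. c * F y) x = c * partial i F x"
  using partial_mult[of "\<lambda>_. c" x F i] assms by simp

lemma partial_sum:
  assumes "\<And>s. s \<in> I \<Longrightarrow> F s differentiable (at x)"
  shows "partial i (\<lambda>y. \<Sum>s\<in>I. F s y) x = (\<Sum>s\<in>I. partial i (F s) x)"
  by (subst partialI[OF has_derivative_sum[of I F, OF frechet_derivative_worksI[OF assms]]])
    (simp_all add: partial_def)

lemma partial_inverse:
  assumes "F differentiable (at x)" "F x \<noteq> 0"
  shows "partial i (\<lambda>y. inverse (F y)) x = - (partial i F x * (inverse (F x) * inverse (F x)))"
  unfolding partialI[OF Deriv.has_derivative_inverse[OF assms(2) frechet_derivative_worksI[OF assms(1)]]]
  by (simp add: partial_def)

lemma has_derivative_vec_components: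
  fixes U :: "'c::real_normed_vector \<Rightarrow> real^'n::finite"
  assumes "\<And>a. ((\<lambda>y. U y $ a) has_derivative (\<lambda>v. U' a v)) (at x)"
  shows "(U has_derivative (\<lambda>v. \<chi> a. U' a v)) (at x)"
proof -
  have "((\<lambda>y. \<Sum>a\<in>UNIV. U y $ a *\<^sub>R axis a (1::real)) has_derivative (\<lambda>v. \<Sum>a\<in>UNIV. U' a v *\<^sub>R axis a 1)) (at x)"
    by (intro has_derivative_sum has_derivative_scaleR_left assms)
  then show ?thesis by (simp only: sum_axis vec_lambda_eta)
qed

lemma compose_derivative:
  fixes U :: "real^'m::finite \<Rightarrow> real^'n::finite"
  assumes F: "F differentiable (at (U x))" and U: "\<And>a. (\<lambda>y. U y $ a) differentiable (at x)"
  shows "(\<lambda>y. F (U y)) differentiable (at x)"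
    and "partial i (\<lambda>y. F (U y)) x = (\<Sum>a\<in>UNIV. partial i (\<lambda>y. U y $ a) x * partial a F (U x))"
proof -
  have D: "((\<lambda>y. F (U y)) has_derivative (\<lambda>v. \<Sum>a\<in>UNIV. (\<chi> a. \<Sum>i\<in>UNIV. v $ i * partial i (\<lambda>y. U y $ a) x) $ a
       * partial a F (U x))) (at x)"
    by (rule has_derivative_compose[OF has_derivative_vec_components[OF has_derivative_partial[OF U]]
          has_derivative_partial[OF F]])
  then show "(\<lambda>y. F (U y)) differentiable (at x)" by (rule differentiableI)
  show "partial i (\<lambda>y. F (U y)) x = (\<Sum>a\<in>UNIV. partial i (\<lambda>y. U y $ a) x * partial a F (U x))"
    unfolding partialI[OF D]
    by (simp add: sum_axis_component)
qed

section \<open>Closure properties of C^k functions\<close>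

lemma Ck_on_imp_continuous: "Ck_on k W F \<Longrightarrow> continuous_on W F"
  by (cases k) (auto intro!: differentiable_imp_continuous_on
      simp: differentiable_on_def differentiable_at_withinI)

lemma Ck_on_SucD: "Ck_on (Suc k) W F \<Longrightarrow> Ck_on k W F"
proof (induction k arbitrary: F)
  case 0
  then show ?case using Ck_on_imp_continuous[of "Suc 0"] by simp
qed auto

lemma Ck_on_subset: "Ck_on k W F \<Longrightarrow> V \<subseteq> W \<Longrightarrow> Ck_on k V F"
  by (induction k arbitrary: F) (auto intro: continuous_on_subset)

lemma Ck_on_cong:
  assumes "open W" "\<And>y. y \<in> W \<Longrightarrow> F y = H y"
  shows "Ck_on k W F \<longleftrightarrow> Ck_on k W H"
  using assms(2)
proof (induction k arbitrary: F H)
  case 0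
  then show ?case using continuous_on_cong by auto
next
  case (Suc k)
  have "Ck_on k W (partial i F) = Ck_on k W (partial i H)" for i
    by (rule Suc.IH) (rule partial_cong[OF assms(1) _ Suc.prems])
  moreover have "F differentiable (at x) \<longleftrightarrow> H differentiable (at x)" if "x \<in> W" for x
    using that by (rule differentiable_cong[OF assms(1) _ Suc.prems])
  ultimately show ?case by simp
qed

text \<open>Differentiability in \<open>Ck_on\<close> is at points of the whole space, so the
  neighbourhoods \<open>V\<close> may change from point to point. \<open>smooth_near_compose\<close>
  needs this, as the target chart used there depends on the point.\<close>

lemma Ck_on_local:
  assumes "\<And>x. x \<in> W \<Longrightarrow> \<exists>V. open V \<and> x \<in> V \<and> Ck_on k V F"
  shows "Ck_on k W F"
  using assms
proof (induction k arbitrary: F)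
  case 0
  show ?case unfolding Ck_on.simps
  proof (rule continuous_at_imp_continuous_on, rule ballI)
    fix x assume "x \<in> W"
    with 0 obtain V where "open V" "x \<in> V" "continuous_on V F" by auto
    then show "continuous (at x) F" by (simp add: continuous_on_eq_continuous_at)
  qed
next
  case (Suc k)
  have "Ck_on k W (partial i F)" for i
    by (rule Suc.IH) (use Suc.prems in fastforce)
  moreover have "\<forall>x\<in>W. F differentiable (at x)" using Suc.prems by fastforce
  ultimately show ?case by simp
qed

lemma Ck_on_const: "Ck_on k W (\<lambda>x. c)"
proof (induction k arbitrary: c)
  case (Suc k)
  have "partial i (\<lambda>x. c) = (\<lambda>x. 0)" for i :: 'a by auto
  with Suc show ?case by simp
qed simp

context
  fixes W :: "(real^'m::finite) set"
  assumes W: "open W"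
begin

lemma Ck_on_add: "Ck_on k W F \<Longrightarrow> Ck_on k W H \<Longrightarrow> Ck_on k W (\<lambda>x. F x + H x)"
proof (induction k arbitrary: F H)
  case (Suc k)
  have "Ck_on k W (partial i (\<lambda>x. F x + H x))" for i
    by (subst Ck_on_cong[OF W, of _ "\<lambda>x. partial i F x + partial i H x"])
      (use Suc in \<open>auto simp: partial_add\<close>)
  with Suc.prems show ?case by simp
qed (simp add: continuous_on_add)

text \<open>The pattern of all these inductions: the formula for the derivative holds on the open
  set \<open>W\<close> only and is substituted by \<open>Ck_on_cong\<close>; undifferentiated
  factors are lowered from \<open>Suc k\<close> to \<open>k\<close> by
  \<open>Ck_on_SucD\<close>.\<close>

lemma Ck_on_mult: "Ck_on k W F \<Longrightarrow> Ck_on k W H \<Longrightarrow> Ck_on k W (\<lambda>x. F x * H x)"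
proof (induction k arbitrary: F H)
  case (Suc k)
  have "Ck_on k W (partial i (\<lambda>x. F x * H x))" for i
    by (subst Ck_on_cong[OF W, of _ "\<lambda>x. partial i F x * H x + F x * partial i H x"])
      (use Suc Ck_on_SucD[OF Suc.prems(1)] Ck_on_SucD[OF Suc.prems(2)] in \<open>auto simp: partial_mult intro!: Ck_on_add\<close>)
  with Suc.prems show ?case by simp
qed (simp add: continuous_on_mult)

lemma Ck_on_sum: "finite I \<Longrightarrow> (\<And>s. s \<in> I \<Longrightarrow> Ck_on k W (F s)) \<Longrightarrow> Ck_on k W (\<lambda>x. \<Sum>s\<in>I. F s x)"
  by (induction I rule: finite_induct) (auto intro: Ck_on_add Ck_on_const)

lemma Ck_on_prod: "finite I \<Longrightarrow> (\<And>s. s \<in> I \<Longrightarrow> Ck_on k W (F s)) \<Longrightarrow> Ck_on k W (\<lambda>x. \<Prod>s\<in>I. F s x)"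
  by (induction I rule: finite_induct) (auto intro: Ck_on_mult Ck_on_const)

lemma Ck_on_inverse:
  "Ck_on k W F \<Longrightarrow> (\<And>x. x \<in> W \<Longrightarrow> F x \<noteq> 0) \<Longrightarrow> Ck_on k W (\<lambda>x. inverse (F x))"
proof (induction k arbitrary: F)
  case 0
  then show ?case by (simp add: continuous_on_inverse)
next
  case (Suc k)
  have "Ck_on k W (partial i (\<lambda>x. inverse (F x)))" for i
  proof (subst Ck_on_cong[OF W])
    fix y assume "y \<in> W"
    \<comment> \<open>The sign is written as a constant factor so that closure under products covers
      it.\<close>
    with Suc.prems show "partial i (\<lambda>x. inverse (F x)) y = (-1) * (partial i F y * (inverse (F y) * inverse (F y)))"
      by (simp add: partial_inverse)
  next
    show "Ck_on k W (\<lambda>y. (-1) * (partial i F y * (inverse (F y) * inverse (F y))))"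
      by (intro Ck_on_mult Ck_on_const) (use Suc Ck_on_SucD[OF Suc.prems(1)] in auto)
  qed
  with Suc.prems show ?case by auto
qed

text \<open>By the chain rule the derivative consists of products of a derivative of
  \<open>U\<close> and some \<open>partial a F\<close> composed with \<open>U\<close>; the induction
  therefore varies \<open>F\<close> and keeps \<open>U\<close>.\<close>

lemma Ck_on_compose:
  fixes U :: "real^'m \<Rightarrow> real^'n::finite"
  assumes "open V" "U ` W \<subseteq> V"
  shows "Ck_on k V F \<Longrightarrow> (\<And>a. Ck_on k W (\<lambda>y. U y $ a)) \<Longrightarrow> Ck_on k W (\<lambda>y. F (U y))"
proof (induction k arbitrary: F)
  case 0
  then have "continuous_on W (\<lambda>y. \<chi> a. U y $ a)" by (intro continuous_on_vec_lambda) auto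
  then have "continuous_on W U" by simp
  with 0 assms(2) show ?case by (metis Ck_on.simps(1) continuous_on_compose2)
next
  case (Suc k)
  have UV: "U y \<in> V" if "y \<in> W" for y using assms that by auto
  have "Ck_on k W (partial i (\<lambda>y. F (U y)))" for i
  proof (subst Ck_on_cong[OF W])
    fix y assume "y \<in> W"
    with Suc.prems UV show "partial i (\<lambda>x. F (U x)) y = (\<Sum>a\<in>UNIV. partial i (\<lambda>y. U y $ a) y * partial a F (U y))"
      by (intro compose_derivative(2)) simp_all
  next
    show "Ck_on k W (\<lambda>y. \<Sum>a\<in>UNIV. partial i (\<lambda>y. U y $ a) y * partial a F (U y))"
    proof (intro Ck_on_sum finite_class.finite_UNIV Ck_on_mult)
      fix a
      show "Ck_on k W (\<lambda>y. partial i (\<lambda>y. U y $ a) y)" using Suc.prems(2) by simp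
      have "Ck_on k V (partial a F)" using Suc.prems(1) by simp
      then show "Ck_on k W (\<lambda>y. partial a F (U y))" by (rule Suc.IH) (rule Ck_on_SucD[OF Suc.prems(2)])
    qed
  qed
  moreover have "(\<lambda>y. F (U y)) differentiable (at y)" if "y \<in> W" for y
    by (rule compose_derivative(1)) (use Suc.prems UV[OF that] that in simp_all)
  ultimately show ?case by simp
qed

end

lemma smooth_on_partial: "smooth_on W F \<Longrightarrow> smooth_on W (partial i F)"
  unfolding smooth_on_def by (metis Ck_on.simps(2))

lemma smooth_on_differentiable: "smooth_on W F \<Longrightarrow> x \<in> W \<Longrightarrow> F differentiable (at x)"
  unfolding smooth_on_def by (metis Ck_on.simps(2))

lemma smooth_on_subset: "smooth_on W F \<Longrightarrow> V \<subseteq> W \<Longrightarrow> smooth_on V F"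
  unfolding smooth_on_def using Ck_on_subset by blast

lemma smooth_on_cong: "open W \<Longrightarrow> (\<And>y. y \<in> W \<Longrightarrow> F y = H y) \<Longrightarrow> smooth_on W F \<longleftrightarrow> smooth_on W H"
  unfolding smooth_on_def using Ck_on_cong by metis

lemma smooth_on_local:
  assumes "\<And>x. x \<in> W \<Longrightarrow> \<exists>V. open V \<and> x \<in> V \<and> smooth_on V F"
  shows "smooth_on W F"
  using assms unfolding smooth_on_def by (meson Ck_on_local)

lemma smooth_on_const: "smooth_on W (\<lambda>x. c)"
  by (simp add: smooth_on_def Ck_on_const)

lemma smooth_on_add: "open W \<Longrightarrow> smooth_on W F \<Longrightarrow> smooth_on W H \<Longrightarrow> smooth_on W (\<lambda>x. F x + H x)"
  and smooth_on_mult: "open W \<Longrightarrow> smooth_on W F \<Longrightarrow> smooth_on W H \<Longrightarrow> smooth_on W (\<lambda>x. F x * H x)"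
  by (simp_all add: smooth_on_def Ck_on_add Ck_on_mult)

lemma smooth_on_diff:
  assumes "open W" "smooth_on W F" "smooth_on W H" shows "smooth_on W (\<lambda>x. F x - H x)"
  using smooth_on_add[OF assms(1,2) smooth_on_mult[OF assms(1) smooth_on_const[of _ "-1"] assms(3)]]
  by simp

lemma smooth_on_sum: "open W \<Longrightarrow> finite I \<Longrightarrow> (\<And>s. s \<in> I \<Longrightarrow> smooth_on W (F s)) \<Longrightarrow> smooth_on W (\<lambda>x. \<Sum>s\<in>I. F s x)"
  and smooth_on_prod: "open W \<Longrightarrow> finite I \<Longrightarrow> (\<And>s. s \<in> I \<Longrightarrow> smooth_on W (F s)) \<Longrightarrow> smooth_on W (\<lambda>x. \<Prod>s\<in>I. F s x)"
  by (simp_all add: smooth_on_def Ck_on_sum Ck_on_prod)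

lemma smooth_on_divide:
  assumes "open W" "smooth_on W F" "smooth_on W H" "\<And>x. x \<in> W \<Longrightarrow> H x \<noteq> 0"
  shows "smooth_on W (\<lambda>x. F x / H x)"
  unfolding divide_inverse using assms Ck_on_inverse[OF assms(1)]
  by (intro smooth_on_mult) (auto simp: smooth_on_def)

lemma smooth_on_compose:
  assumes "open W" "open V" "U ` W \<subseteq> V" "smooth_on V F" "\<And>a. smooth_on W (\<lambda>y. U y $ a)"
  shows "smooth_on W (\<lambda>y. F (U y))"
  using assms Ck_on_compose[of W V U] by (auto simp: smooth_on_def)

section \<open>Determinants and inverse matrices\<close>

lemma smooth_on_det:
  fixes M :: "real^'m::finite \<Rightarrow> real^'n::finite^'n"
  assumes "open W" "\<And>i j. smooth_on W (\<lambda>x. M x $ i $ j)"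
  shows "smooth_on W (\<lambda>x. det (M x))"
  unfolding det_def using assms
  by (intro smooth_on_sum smooth_on_mult smooth_on_prod smooth_on_const) auto

lemma matrix_inv_mult:
  fixes M :: "real^'n::finite^'n"
  assumes "invertible M"
  shows "M ** matrix_inv M = mat 1" "matrix_inv M ** M = mat 1"
  using assms someI_ex[of "\<lambda>A'. M ** A' = mat 1 \<and> A' ** M = mat 1"]
  unfolding matrix_inv_def invertible_def by auto

text \<open>Column \<open>l\<close> of the inverse solves M v = e_l, so Cramer's rule applies. It
  makes the entries of the inverse quotients of polynomials in the entries of \<open>M\<close>,
  whence their smoothness.\<close>

lemma matrix_inv_cramer:
  fixes M :: "real^'n::finite^'n"
  assumes "invertible M"
  shows "matrix_inv M $ k $ l = det (\<chi> i j. if j = k then axis l 1 $ i else M $ i $ j) / det M"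
proof -
  have "M *v (column l (matrix_inv M)) = axis l 1"
    using matrix_inv_mult(1)[OF assms]
    by (auto simp: vec_eq_iff matrix_vector_mult_def matrix_matrix_mult_def column_def axis_def mat_def)
  then show ?thesis
    using cramer[of M "column l (matrix_inv M)" "axis l 1"] assms
    by (simp add: invertible_det_nz column_def vec_eq_iff)
qed

lemma smooth_on_matrix_inv:
  fixes M :: "real^'m::finite \<Rightarrow> real^'n::finite^'n"
  assumes W: "open W" and M: "\<And>i j. smooth_on W (\<lambda>x. M x $ i $ j)" and inv: "\<And>x. x \<in> W \<Longrightarrow> invertible (M x)"
  shows "smooth_on W (\<lambda>x. matrix_inv (M x) $ k $ l)"
proof (subst smooth_on_cong[OF W matrix_inv_cramer[OF inv]])
  have "smooth_on W (\<lambda>y. if j = k then axis l 1 $ i else M y $ i $ j)" for i j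
    using M by (cases "j = k") (simp_all add: smooth_on_const)
  then show "smooth_on W (\<lambda>y. det (\<chi> i j. if j = k then axis l 1 $ i else M y $ i $ j) / det (M y))"
    using inv M by (intro smooth_on_divide W smooth_on_det) (simp_all add: invertible_det_nz)
qed

section \<open>Symmetry of second partial derivatives\<close>

lemma second_difference:
  fixes F :: "real^'m::finite \<Rightarrow> real"
  assumes F: "smooth_on (ball x r) F" and s: "0 < s" "2 * s < r"
  shows "\<exists>y. dist x y \<le> 2 * s \<and> F (x + s *\<^sub>R axis i 1 + s *\<^sub>R axis j 1) - F (x + s *\<^sub>R axis i 1)
     - F (x + s *\<^sub>R axis j 1) + F x = s * s * partial j (partial i F) y"
proof -
  define e :: "'m \<Rightarrow> real^'m" where "e k = axis k 1" for k
  have norm_le: "norm (a *\<^sub>R e i + b *\<^sub>R e j) \<le> 2 * s" if "0 \<le> a" "a \<le> s" "0 \<le> b" "b \<le> s" for a b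
    using norm_triangle_ineq[of "a *\<^sub>R e i" "b *\<^sub>R e j"] that by (simp add: e_def)
  have in_ball: "x + a *\<^sub>R e i + b *\<^sub>R e j \<in> ball x r" if "0 \<le> a" "a \<le> s" "0 \<le> b" "b \<le> s" for a b
    using norm_le[OF that] s by (simp add: dist_norm add.assoc norm_minus_commute add.commute[of "b *\<^sub>R e j"])
  have line: "((\<lambda>a. H (v + a *\<^sub>R e k)) has_real_derivative partial k H (v + a *\<^sub>R e k)) (at a)"
    if "smooth_on (ball x r) H" "v + a *\<^sub>R e k \<in> ball x r" for H v a k
  proof -
    have "((\<lambda>a. v + a *\<^sub>R e k) has_derivative (\<lambda>t. t *\<^sub>R e k)) (at a)"
      by (auto intro!: derivative_eq_intros)
    note D = has_derivative_compose[OF this has_derivative_partial[OF smooth_on_differentiable[OF that]]]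
    have "(\<Sum>i\<in>UNIV. (t *\<^sub>R e k) $ i * c i) = c k * t" for t and c :: "'m \<Rightarrow> real"
      by (simp add: e_def mult.assoc sum_distrib_left[symmetric] sum_axis_component)
    then show ?thesis using D by (simp add: has_field_derivative_def)
  qed
  have line_i: "((\<lambda>a. F (x + a *\<^sub>R e i + b *\<^sub>R e j)) has_real_derivative partial i F (x + a *\<^sub>R e i + b *\<^sub>R e j)) (at a)"
    if "0 \<le> a" "a \<le> s" "0 \<le> b" "b \<le> s" for a b
    using line[OF F, of "x + b *\<^sub>R e j" a i] in_ball[OF that] by (simp add: algebra_simps)
  \<comment> \<open>The second difference is the increment in direction \<open>i\<close> of the
    increment in direction \<open>j\<close>; the mean value theorem is applied first to the outer
    increment and then to the inner one. The summand \<open>0 *\<^sub>R e j\<close> keeps both terms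
    instances of \<open>line_i\<close>.\<close>
  let ?\<psi> = "\<lambda>a. F (x + a *\<^sub>R e i + s *\<^sub>R e j) - F (x + a *\<^sub>R e i + 0 *\<^sub>R e j)"
  have "\<exists>\<theta>. 0 < \<theta> \<and> \<theta> < s \<and> ?\<psi> s - ?\<psi> 0 = (s - 0) *
      (partial i F (x + \<theta> *\<^sub>R e i + s *\<^sub>R e j) - partial i F (x + \<theta> *\<^sub>R e i + 0 *\<^sub>R e j))"
    using s by (intro MVT2[where f = ?\<psi>] DERIV_diff line_i) auto
  then obtain \<theta> where \<theta>: "0 < \<theta>" "\<theta> < s" "?\<psi> s - ?\<psi> 0 = s *
      (partial i F (x + \<theta> *\<^sub>R e i + s *\<^sub>R e j) - partial i F (x + \<theta> *\<^sub>R e i + 0 *\<^sub>R e j))"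
    by auto
  have "\<exists>\<eta>. 0 < \<eta> \<and> \<eta> < s \<and> partial i F (x + \<theta> *\<^sub>R e i + s *\<^sub>R e j) - partial i F (x + \<theta> *\<^sub>R e i + 0 *\<^sub>R e j)
     = (s - 0) * partial j (partial i F) (x + \<theta> *\<^sub>R e i + \<eta> *\<^sub>R e j)"
    using s \<theta> by (intro MVT2 line smooth_on_partial F in_ball) auto
  then obtain \<eta> where \<eta>: "0 < \<eta>" "\<eta> < s" "partial i F (x + \<theta> *\<^sub>R e i + s *\<^sub>R e j) - partial i F (x + \<theta> *\<^sub>R e i + 0 *\<^sub>R e j)
     = s * partial j (partial i F) (x + \<theta> *\<^sub>R e i + \<eta> *\<^sub>R e j)"
    by auto
  have dist_add: "dist x (x + v) = norm v" for v
    by (simp add: dist_norm)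
  have "dist x (x + \<theta> *\<^sub>R e i + \<eta> *\<^sub>R e j) \<le> 2 * s"
    using norm_le[of \<theta> \<eta>] \<theta>(1,2) \<eta>(1,2) dist_add[of "\<theta> *\<^sub>R e i + \<eta> *\<^sub>R e j"]
    by (simp add: add.assoc)
  with \<theta>(3) \<eta>(3) show ?thesis by (auto simp: e_def algebra_simps intro!: exI[of _ "x + \<theta> *\<^sub>R e i + \<eta> *\<^sub>R e j"])
qed

text \<open>The second difference is symmetric in \<open>i\<close> and \<open>j\<close>, but
  \<open>second_difference\<close> equates it with s^2 times either mixed derivative, each taken at
  some point close to \<open>x\<close>. Continuity of the two derivatives then forces equality at
  \<open>x\<close>.\<close>

lemma partial_commute:
  fixes F :: "real^'m::finite \<Rightarrow> real"
  assumes W: "open W" "x \<in> W" and F: "smooth_on W F"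
  shows "partial i (partial j F) x = partial j (partial i F) x"
proof (rule ccontr)
  assume neq: "\<not> ?thesis"
  \<comment> \<open>Half of the gap: two strict errors of this size cannot bridge it.\<close>
  define \<epsilon> where "\<epsilon> = \<bar>partial i (partial j F) x - partial j (partial i F) x\<bar> / 2"
  have "\<epsilon> > 0" using neq by (simp add: \<epsilon>_def)
  obtain r where r: "r > 0" "ball x r \<subseteq> W" using W open_contains_ball by blast
  have Fr: "smooth_on (ball x r) F" using F r smooth_on_subset by blast
  have "isCont (partial k (partial l F)) x" for k l
    using smooth_on_differentiable[OF smooth_on_partial[OF smooth_on_partial[OF F]] W(2)]
      differentiable_imp_continuous_within by blast
  then have cont: "\<exists>d>0. \<forall>y. dist x y < d \<longrightarrow> \<bar>partial k (partial l F) y - partial k (partial l F) x\<bar> < \<epsilon>" for k l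
    using \<open>\<epsilon> > 0\<close> unfolding continuous_at_eps_delta by (metis dist_commute dist_real_def)
  obtain d1 where d1: "d1 > 0" "\<And>y. dist x y < d1 \<Longrightarrow> \<bar>partial i (partial j F) y - partial i (partial j F) x\<bar> < \<epsilon>"
    using cont by blast
  obtain d2 where d2: "d2 > 0" "\<And>y. dist x y < d2 \<Longrightarrow> \<bar>partial j (partial i F) y - partial j (partial i F) x\<bar> < \<epsilon>"
    using cont by blast
  \<comment> \<open>Division by 3 makes \<open>2 * s\<close>, the distance bound of
    \<open>second_difference\<close>, strictly smaller than each radius.\<close>
  define s where "s = min r (min d1 d2) / 3"
  have s: "s > 0" "2 * s < r" "2 * s < d1" "2 * s < d2" using r d1 d2 by (auto simp: s_def)
  obtain y where y: "dist x y \<le> 2 * s" "F (x + s *\<^sub>R axis i 1 + s *\<^sub>R axis j 1) - F (x + s *\<^sub>R axis i 1)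
     - F (x + s *\<^sub>R axis j 1) + F x = s * s * partial j (partial i F) y"
    using second_difference[OF Fr s(1,2)] by blast
  obtain z where z: "dist x z \<le> 2 * s" "F (x + s *\<^sub>R axis j 1 + s *\<^sub>R axis i 1) - F (x + s *\<^sub>R axis j 1)
     - F (x + s *\<^sub>R axis i 1) + F x = s * s * partial i (partial j F) z"
    using second_difference[OF Fr s(1,2)] by blast
  have "s * s * partial j (partial i F) y = s * s * partial i (partial j F) z"
    using y(2) z(2) by (simp add: algebra_simps)
  with s have "partial j (partial i F) y = partial i (partial j F) z" by simp
  moreover have "\<bar>partial j (partial i F) y - partial j (partial i F) x\<bar> < \<epsilon>"
    "\<bar>partial i (partial j F) z - partial i (partial j F) x\<bar> < \<epsilon>"
    using y(1) z(1) s d1 d2 by auto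
  ultimately show False unfolding \<epsilon>_def by (auto simp: abs_if split: if_splits)
qed

section \<open>Riemannian geometry in coordinates\<close>

lemma matrix_add_rdistrib: "(B + C) ** A = B ** A + C ** (A :: 'a::semiring_1^'n^'m)"
  by (simp add: vec_eq_iff matrix_matrix_mult_def distrib_right sum.distrib)

lemma matrix_diff_ldistrib: "A ** (B - C) = A ** B - A ** (C :: 'a::ring_1^'n^'m)"
  by (simp add: vec_eq_iff matrix_matrix_mult_def right_diff_distrib sum_subtractf)

lemma matrix_diff_rdistrib: "(B - C) ** A = B ** A - C ** (A :: 'a::ring_1^'n^'m)"
  by (simp add: vec_eq_iff matrix_matrix_mult_def left_diff_distrib sum_subtractf)

lemma transpose_add: "transpose (A + B) = transpose A + transpose B"
  and transpose_diff: "transpose (C - D) = transpose C - transpose (D :: 'a::ab_group_add^'n^'m)"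
  by (simp_all add: vec_eq_iff transpose_def)

text \<open>Multiplies matrix expressions out and brackets products to the left, so that only
  cancellation in an abelian group remains.\<close>

lemmas matrix_algebra = matrix_add_ldistrib matrix_add_rdistrib matrix_diff_ldistrib matrix_diff_rdistrib
  matrix_mul_assoc transpose_add transpose_diff matrix_transpose_mul transpose_transpose

definition matrix_partial :: "'m::finite \<Rightarrow> (real^'m \<Rightarrow> real^'n::finite^'k::finite) \<Rightarrow> real^'m \<Rightarrow> real^'n^'k" where
  "matrix_partial i M x = (\<chi> a b. partial i (\<lambda>y. M y $ a $ b) x)"

lemma matrix_partial_add:
  assumes "\<And>a b. (\<lambda>y. M y $ a $ b) differentiable (at x)" "\<And>a b. (\<lambda>y. N y $ a $ b) differentiable (at x)"
  shows "matrix_partial i (\<lambda>y. M y + N y) x = matrix_partial i M x + matrix_partial i N x"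
    and "matrix_partial i (\<lambda>y. M y - N y) x = matrix_partial i M x - matrix_partial i N x"
  using assms by (simp_all add: vec_eq_iff matrix_partial_def partial_add partial_diff)

lemma matrix_partial_mult:
  assumes "\<And>a b. (\<lambda>y. M y $ a $ b) differentiable (at x)" "\<And>a b. (\<lambda>y. N y $ a $ b) differentiable (at x)"
  shows "matrix_partial i (\<lambda>y. M y ** N y) x = matrix_partial i M x ** N x + M x ** matrix_partial i N x"
  using assms
  by (simp add: vec_eq_iff matrix_partial_def matrix_matrix_mult_def partial_sum partial_mult sum.distrib)

lemma matrix_partial_transpose: "matrix_partial i (\<lambda>y. transpose (M y)) x = transpose (matrix_partial i M x)"
  by (simp add: vec_eq_iff matrix_partial_def transpose_def)

lemma matrix_partial_cong:
  assumes "open W" "x \<in> W" "\<And>y. y \<in> W \<Longrightarrow> M y = N y"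
  shows "matrix_partial i M x = matrix_partial i N x"
  unfolding matrix_partial_def using assms by (auto simp: vec_eq_iff intro!: partial_cong[of W])

lemma matrix_partial_commute:
  assumes "open W" "x \<in> W" "\<And>a b. smooth_on W (\<lambda>y. M y $ a $ b)"
  shows "matrix_partial i (matrix_partial j M) x = matrix_partial j (matrix_partial i M) x"
  unfolding matrix_partial_def using partial_commute[OF assms]
  by (simp add: vec_eq_iff)

lemma sum_rotate3: "(\<Sum>i\<in>I. \<Sum>j\<in>J. \<Sum>k\<in>K. f i j k) = (\<Sum>k\<in>K. \<Sum>i\<in>I. \<Sum>j\<in>J. f i j k)"
proof -
  have "(\<Sum>i\<in>I. \<Sum>j\<in>J. \<Sum>k\<in>K. f i j k) = (\<Sum>i\<in>I. \<Sum>k\<in>K. \<Sum>j\<in>J. f i j k)"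
    by (rule sum.cong[OF refl], rule sum.swap)
  also have "\<dots> = (\<Sum>k\<in>K. \<Sum>i\<in>I. \<Sum>j\<in>J. f i j k)"
    by (rule sum.swap)
  finally show ?thesis .
qed

lemma sum_swap_pairs:
  "(\<Sum>i\<in>I. \<Sum>j\<in>J. \<Sum>k\<in>K. \<Sum>l\<in>L. f i j k l) = (\<Sum>k\<in>K. \<Sum>l\<in>L. \<Sum>i\<in>I. \<Sum>j\<in>J. f i j k l)"
proof -
  have "(\<Sum>i\<in>I. \<Sum>j\<in>J. \<Sum>k\<in>K. \<Sum>l\<in>L. f i j k l) = (\<Sum>k\<in>K. \<Sum>i\<in>I. \<Sum>j\<in>J. \<Sum>l\<in>L. f i j k l)"
    by (rule sum_rotate3)
  also have "\<dots> = (\<Sum>k\<in>K. \<Sum>l\<in>L. \<Sum>i\<in>I. \<Sum>j\<in>J. f i j k l)"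
    by (rule sum.cong[OF refl], rule sum_rotate3)
  finally show ?thesis .
qed

text \<open>A metric in coordinates. Positive definiteness of a Riemannian metric enters as
  \<open>invertible_G\<close>, which is derived in \<open>metric_coordinates_chart\<close>; there
  \<open>W\<close> is an open part of the image of a chart.\<close>

locale metric_coordinates =
  fixes W :: "(real^'m::finite) set" and G :: "'m field2"
  assumes open_W: "open W"
    and smooth_G: "\<And>i j. smooth_on W (\<lambda>x. G x $ i $ j)"
    and sym_G: "\<And>x i j. x \<in> W \<Longrightarrow> G x $ i $ j = G x $ j $ i"
    and invertible_G: "\<And>x. x \<in> W \<Longrightarrow> invertible (G x)"
begin

section \<open>Inverse metric and Christoffel symbols\<close>

abbreviation gi :: "'m \<Rightarrow> 'm \<Rightarrow> real^'m \<Rightarrow> real" where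
  "gi i j x \<equiv> ginv G x $ i $ j"

abbreviation \<Gamma> :: "'m \<Rightarrow> 'm \<Rightarrow> 'm \<Rightarrow> real^'m \<Rightarrow> real" where
  "\<Gamma> \<equiv> christoffel G"

lemmas differentiable = smooth_on_differentiable

lemma smooth_gi: "smooth_on W (gi i j)"
  unfolding ginv_def by (rule smooth_on_matrix_inv[OF open_W smooth_G invertible_G])

lemma smooth_partial_G: "smooth_on W (partial k (\<lambda>x. G x $ i $ j))"
  by (rule smooth_on_partial[OF smooth_G])

lemma smooth_christoffel: "smooth_on W (\<Gamma> k i j)"
proof -
  have "smooth_on W (\<lambda>x. \<Gamma> k i j x)"
    unfolding christoffel_def
    by (intro smooth_on_mult smooth_on_const smooth_on_sum smooth_on_add smooth_on_diff open_W
        finite_class.finite_UNIV smooth_gi smooth_partial_G)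
  then show ?thesis by simp
qed

lemma smooth_curvature: "smooth_on W (curvature G i j k l)"
proof -
  have "smooth_on W (\<lambda>x. curvature G i j k l x)"
    unfolding curvature_def
    by (intro smooth_on_mult smooth_on_sum smooth_on_add smooth_on_diff open_W
        finite_class.finite_UNIV smooth_on_partial smooth_christoffel)
  then show ?thesis by simp
qed

lemma smooth_ricci: "smooth_on W (\<lambda>x. ricci G x $ j $ k)"
  unfolding ricci_def by (simp, intro smooth_on_sum open_W finite_class.finite_UNIV smooth_curvature)

lemma smooth_trace2: "(\<And>i j. smooth_on W (\<lambda>x. T x $ i $ j)) \<Longrightarrow> smooth_on W (trace2 G T)"
  unfolding trace2_def
  by (intro smooth_on_sum open_W finite_class.finite_UNIV smooth_gi smooth_on_mult)

lemma smooth_hessian: "smooth_on W F \<Longrightarrow> smooth_on W (\<lambda>x. hessian G F x $ i $ j)"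
  unfolding hessian_def
  by (simp, intro smooth_on_diff smooth_on_sum open_W finite_class.finite_UNIV smooth_christoffel
      smooth_on_mult smooth_on_partial)

context
  fixes x assumes x: "x \<in> W"
begin

lemma G_ginv: "G x ** ginv G x = mat 1" "ginv G x ** G x = mat 1"
  using matrix_inv_mult[OF invertible_G[OF x]] by (simp_all add: ginv_def)

lemma transpose_G: "transpose (G x) = G x"
  using sym_G[OF x] by (simp add: vec_eq_iff transpose_def)

lemma transpose_ginv: "transpose (ginv G x) = ginv G x"
proof -
  have "transpose (ginv G x) ** G x = mat 1"
    using G_ginv(1) by (metis matrix_transpose_mul transpose_G transpose_mat)
  then show ?thesis by (metis G_ginv(1) matrix_mul_assoc matrix_mul_lid matrix_mul_rid)
qed

lemma gi_commute: "gi i j x = gi j i x"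
proof -
  have "transpose (ginv G x) $ i $ j = ginv G x $ i $ j" by (simp only: transpose_ginv)
  then show ?thesis by (simp add: transpose_def)
qed

lemma sum_G_gi: "(\<Sum>k\<in>UNIV. G x $ i $ k * gi k j x) = (if i = j then 1 else 0)"
  and sum_gi_G: "(\<Sum>k\<in>UNIV. gi i k x * G x $ k $ j) = (if i = j then 1 else 0)"
  using G_ginv by (simp_all add: vec_eq_iff matrix_matrix_mult_def mat_def)

lemma partial_G_commute: "partial k (\<lambda>y. G y $ i $ j) x = partial k (\<lambda>y. G y $ j $ i) x"
  by (rule partial_cong[OF open_W x sym_G])

lemma christoffel_commute: "\<Gamma> k i j x = \<Gamma> k j i x"
  unfolding christoffel_def using partial_G_commute by (simp add: add.commute)

text \<open>Lowering the upper index cancels the inverse metric and leaves the Christoffel symbols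
  of the first kind.\<close>

lemma christoffel_lower:
  "(\<Sum>p\<in>UNIV. G x $ k $ p * \<Gamma> p i j x) = 1/2 * (partial i (\<lambda>y. G y $ j $ k) x
     + partial j (\<lambda>y. G y $ i $ k) x - partial k (\<lambda>y. G y $ i $ j) x)"
proof -
  define c where "c l = partial i (\<lambda>y. G y $ j $ l) x + partial j (\<lambda>y. G y $ i $ l) x - partial l (\<lambda>y. G y $ i $ j) x" for l
  have "\<Gamma> p i j x = 1/2 * (\<Sum>l\<in>UNIV. gi p l x * c l)" for p
    by (simp add: christoffel_def c_def)
  then have "(\<Sum>p\<in>UNIV. G x $ k $ p * \<Gamma> p i j x) = 1/2 * (\<Sum>p\<in>UNIV. \<Sum>l\<in>UNIV. G x $ k $ p * gi p l x * c l)"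
    by (simp add: sum_distrib_left mult.assoc mult.left_commute)
  also have "\<dots> = 1/2 * (\<Sum>l\<in>UNIV. (\<Sum>p\<in>UNIV. G x $ k $ p * gi p l x) * c l)"
    by (subst sum.swap) (simp add: sum_distrib_right)
  also have "\<dots> = 1/2 * c k"
    by (simp add: sum_G_gi if_distrib if_distribR cong: if_cong)
  finally show ?thesis by (simp add: c_def)
qed

text \<open>The metric is parallel: in the sum of the two symbols of the first kind all derivatives
  except those in direction \<open>i\<close> cancel.\<close>

lemma metric_compatible:
  "partial i (\<lambda>y. G y $ j $ k) x = (\<Sum>p\<in>UNIV. \<Gamma> p i j x * G x $ p $ k) + (\<Sum>p\<in>UNIV. \<Gamma> p i k x * G x $ j $ p)"
proof -
  have "(\<Sum>p\<in>UNIV. \<Gamma> p i j x * G x $ p $ k) = (\<Sum>p\<in>UNIV. G x $ k $ p * \<Gamma> p i j x)"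
    using sym_G[OF x] by (simp add: mult.commute)
  moreover have "(\<Sum>p\<in>UNIV. \<Gamma> p i k x * G x $ j $ p) = (\<Sum>p\<in>UNIV. G x $ j $ p * \<Gamma> p i k x)"
    by (simp add: mult.commute)
  ultimately show ?thesis
    using partial_G_commute[of i j k] partial_G_commute[of k j i] partial_G_commute[of j i k]
    by (simp add: christoffel_lower)
qed

end

section \<open>Connection and curvature as matrices\<close>

definition conn :: "'m \<Rightarrow> real^'m \<Rightarrow> real^'m^'m" where
  "conn i x = (\<chi> l k. \<Gamma> l i k x)"

text \<open>The endomorphism R(d_i, d_j) of the tangent space. As in \<open>conn\<close>, the row is
  the upper index, so composition of endomorphisms is matrix multiplication.\<close>

definition curv :: "'m \<Rightarrow> 'm \<Rightarrow> real^'m \<Rightarrow> real^'m^'m" where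
  "curv i j x = (\<chi> l k. curvature G i j k l x)"

lemma smooth_conn: "smooth_on W (\<lambda>x. conn i x $ l $ k)"
  by (simp add: conn_def smooth_christoffel)

lemma smooth_curv: "smooth_on W (\<lambda>x. curv i j x $ l $ k)"
  by (simp add: curv_def smooth_curvature)

lemma smooth_matrix_partial: "(\<And>a b. smooth_on W (\<lambda>y. M y $ a $ b)) \<Longrightarrow> smooth_on W (\<lambda>x. matrix_partial i M x $ a $ b)"
  by (simp add: matrix_partial_def smooth_on_partial)

lemma smooth_matrix_mult: "(\<And>a b. smooth_on W (\<lambda>y. M y $ a $ b)) \<Longrightarrow> (\<And>a b. smooth_on W (\<lambda>y. N y $ a $ b))
  \<Longrightarrow> smooth_on W (\<lambda>x. (M x ** N x) $ a $ b)"
  by (simp add: matrix_matrix_mult_def, intro smooth_on_sum smooth_on_mult open_W finite_class.finite_UNIV)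

lemma smooth_matrix_add: "(\<And>a b. smooth_on W (\<lambda>y. M y $ a $ b)) \<Longrightarrow> (\<And>a b. smooth_on W (\<lambda>y. N y $ a $ b))
  \<Longrightarrow> smooth_on W (\<lambda>x. (M x + N x) $ a $ b)"
  and smooth_matrix_diff: "(\<And>a b. smooth_on W (\<lambda>y. M y $ a $ b)) \<Longrightarrow> (\<And>a b. smooth_on W (\<lambda>y. N y $ a $ b))
  \<Longrightarrow> smooth_on W (\<lambda>x. (M x - N x) $ a $ b)"
  by (simp_all add: smooth_on_add smooth_on_diff open_W)

lemma smooth_matrix_transpose: "(\<And>a b. smooth_on W (\<lambda>y. M y $ a $ b)) \<Longrightarrow> smooth_on W (\<lambda>x. transpose (M x) $ a $ b)"
  by (simp add: transpose_def)

lemmas smooth_matrix = smooth_matrix_partial smooth_matrix_mult smooth_matrix_add smooth_matrix_diff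
  smooth_matrix_transpose smooth_conn smooth_G

text \<open>With A_i for \<open>conn i\<close>, this is the structure equation F_ij = d_i A_j - d_j
  A_i + [A_i, A_j].\<close>

lemma curv_eq:
  "curv i j x = matrix_partial i (conn j) x - matrix_partial j (conn i) x + conn i x ** conn j x - conn j x ** conn i x"
  by (simp add: vec_eq_iff curv_def curvature_def conn_def matrix_partial_def matrix_matrix_mult_def
      sum_subtractf mult.commute)

lemma matrix_partial_G:
  assumes "x \<in> W"
  shows "matrix_partial i G x = transpose (conn i x) ** G x + G x ** conn i x"
  using metric_compatible[OF assms] sym_G[OF assms]
  by (simp add: vec_eq_iff matrix_partial_def conn_def transpose_def matrix_matrix_mult_def mult.commute)

context
  fixes x assumes x: "x \<in> W"
begin

text \<open>Obtained by differentiating G G^-1 = 1 and inserting the derivative of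
  \<open>G\<close>.\<close>

lemma matrix_partial_ginv:
  "matrix_partial i (ginv G) x = - (ginv G x ** transpose (conn i x) + conn i x ** ginv G x)"
proof -
  note D = differentiable[OF smooth_G x] differentiable[OF smooth_gi x]
  have "matrix_partial i (\<lambda>y. G y ** ginv G y) x = matrix_partial i (\<lambda>y. mat 1) x"
    using G_ginv(1) by (rule matrix_partial_cong[OF open_W x])
  then have "matrix_partial i G x ** ginv G x + G x ** matrix_partial i (ginv G) x = 0"
    unfolding matrix_partial_mult[OF D] by (simp add: matrix_partial_def vec_eq_iff)
  then have "ginv G x ** (matrix_partial i G x ** ginv G x) + ginv G x ** (G x ** matrix_partial i (ginv G) x) = 0"
    by (metis matrix_add_ldistrib times0_right)
  then have "ginv G x ** matrix_partial i G x ** ginv G x + matrix_partial i (ginv G) x = 0"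
    by (simp add: matrix_mul_assoc G_ginv[OF x])
  moreover have "ginv G x ** matrix_partial i G x ** ginv G x = ginv G x ** transpose (conn i x) + conn i x ** ginv G x"
  proof -
    have "ginv G x ** transpose (conn i x) ** G x ** ginv G x = ginv G x ** transpose (conn i x)"
      by (metis G_ginv(1)[OF x] matrix_mul_assoc matrix_mul_rid)
    moreover have "ginv G x ** G x ** conn i x ** ginv G x = conn i x ** ginv G x"
      by (simp add: G_ginv[OF x])
    ultimately show ?thesis by (simp add: matrix_partial_G[OF x] matrix_algebra)
  qed
  ultimately show ?thesis by (metis add_eq_0_iff2 add.commute minus_unique)
qed

lemma partial_gi: "partial i (gi a b) x = - (\<Sum>p\<in>UNIV. \<Gamma> b i p x * gi a p x) - (\<Sum>p\<in>UNIV. \<Gamma> a i p x * gi p b x)"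
proof -
  have "partial i (gi a b) x = matrix_partial i (ginv G) x $ a $ b" by (simp add: matrix_partial_def)
  then show ?thesis by (simp add: matrix_partial_ginv matrix_matrix_mult_def transpose_def conn_def mult.commute)
qed

text \<open>The inverse metric is parallel, so contracting with it commutes with covariant derivatives.\<close>

lemma partial_contract:
  assumes T: "\<And>a b. smooth_on W (T a b)"
  shows "partial i (\<lambda>y. \<Sum>a\<in>UNIV. \<Sum>b\<in>UNIV. gi a b y * T a b y) x
     = (\<Sum>a\<in>UNIV. \<Sum>b\<in>UNIV. gi a b x * (partial i (T a b) x
         - (\<Sum>p\<in>UNIV. \<Gamma> p i a x * T p b x) - (\<Sum>p\<in>UNIV. \<Gamma> p i b x * T a p x)))"
proof -
  note D = differentiable[OF smooth_gi x] differentiable[OF T x]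
  have "partial i (\<lambda>y. \<Sum>a\<in>UNIV. \<Sum>b\<in>UNIV. gi a b y * T a b y) x
     = (\<Sum>a\<in>UNIV. \<Sum>b\<in>UNIV. partial i (gi a b) x * T a b x + gi a b x * partial i (T a b) x)"
    using D by (simp add: partial_sum partial_mult)
  also have "\<dots> = (\<Sum>a\<in>UNIV. \<Sum>b\<in>UNIV. gi a b x * partial i (T a b) x)
      - (\<Sum>a\<in>UNIV. \<Sum>b\<in>UNIV. \<Sum>p\<in>UNIV. \<Gamma> b i p x * gi a p x * T a b x)
      - (\<Sum>a\<in>UNIV. \<Sum>b\<in>UNIV. \<Sum>p\<in>UNIV. \<Gamma> a i p x * gi p b x * T a b x)"
    by (simp add: partial_gi algebra_simps sum.distrib sum_subtractf sum_distrib_left sum_negf)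
  \<comment> \<open>The corrections carry the inner summation index on the inverse metric;
    exchanging the names of the indices moves it onto \<open>T\<close>.\<close>
  also have "(\<Sum>a\<in>UNIV. \<Sum>b\<in>UNIV. \<Sum>p\<in>UNIV. \<Gamma> b i p x * gi a p x * T a b x)
    = (\<Sum>a\<in>UNIV. \<Sum>b\<in>UNIV. gi a b x * (\<Sum>p\<in>UNIV. \<Gamma> p i b x * T a p x))"
    by (rule sum.cong[OF refl], subst sum.swap) (simp add: sum_distrib_left mult_ac)
  also have "(\<Sum>a\<in>UNIV. \<Sum>b\<in>UNIV. \<Sum>p\<in>UNIV. \<Gamma> a i p x * gi p b x * T a b x)
    = (\<Sum>a\<in>UNIV. \<Sum>b\<in>UNIV. gi a b x * (\<Sum>p\<in>UNIV. \<Gamma> p i a x * T p b x))"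
  proof -
    have "(\<Sum>a\<in>UNIV. \<Sum>b\<in>UNIV. \<Sum>p\<in>UNIV. \<Gamma> a i p x * gi p b x * T a b x)
      = (\<Sum>a\<in>UNIV. \<Sum>p\<in>UNIV. \<Sum>b\<in>UNIV. \<Gamma> a i p x * gi p b x * T a b x)"
      by (rule sum.cong[OF refl], rule sum.swap)
    also have "\<dots> = (\<Sum>p\<in>UNIV. \<Sum>a\<in>UNIV. \<Sum>b\<in>UNIV. \<Gamma> a i p x * gi p b x * T a b x)"
      by (rule sum.swap)
    also have "\<dots> = (\<Sum>p\<in>UNIV. \<Sum>b\<in>UNIV. \<Sum>a\<in>UNIV. \<Gamma> a i p x * gi p b x * T a b x)"
      by (rule sum.cong[OF refl], rule sum.swap)
    finally show ?thesis by (simp add: sum_distrib_left mult_ac)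
  qed
  finally show ?thesis by (simp add: right_diff_distrib sum_subtractf)
qed

lemma partial_trace2:
  assumes "\<And>a b. smooth_on W (\<lambda>y. T y $ a $ b)"
  shows "partial k (trace2 G T) x = (\<Sum>i\<in>UNIV. \<Sum>j\<in>UNIV. gi i j x * nabla2 G T k i j x)"
  using partial_contract[of "\<lambda>a b y. T y $ a $ b", OF assms] by (simp add: trace2_def[abs_def] nabla2_def)

text \<open>
  The second Bianchi identity, with only the endomorphism indices differentiated covariantly: the
  corrections for the other two cancel in the cyclic sum, as the connection is symmetric.
\<close>

lemma bianchi_curv:
  defines "D m i j \<equiv> matrix_partial m (curv i j) x + conn m x ** curv i j x - curv i j x ** conn m x"
  shows "D m i j + D i j m + D j m i = 0"
proof -
  note sm = smooth_matrix
  have dcurv: "matrix_partial m (curv i j) x = matrix_partial m (matrix_partial i (conn j)) x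
      - matrix_partial m (matrix_partial j (conn i)) x
      + (matrix_partial m (conn i) x ** conn j x + conn i x ** matrix_partial m (conn j) x)
      - (matrix_partial m (conn j) x ** conn i x + conn j x ** matrix_partial m (conn i) x)" for m i j
    unfolding curv_eq[abs_def]
    by (simp only: matrix_partial_add matrix_partial_mult differentiable[OF _ x] sm)
  show ?thesis
    \<comment> \<open>Second derivatives of the connection matrices cancel by symmetry, the products
      with first derivatives cancel by the Leibniz rule, and the cubic terms by the Jacobi
      identity.\<close>
    using matrix_partial_commute[OF open_W x smooth_conn, of m i j]
      matrix_partial_commute[OF open_W x smooth_conn, of i j m]
      matrix_partial_commute[OF open_W x smooth_conn, of j m i]
    unfolding D_def dcurv by (simp add: curv_eq matrix_algebra)
qed

text \<open>The commutator of the second partial derivatives of \<open>G\<close>, computed from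
  \<open>matrix_partial_G\<close>, is the left-hand side up to sign: R(d_i, d_j) is skew for a
  metric that is parallel.\<close>

lemma curv_skew: "G x ** curv i j x + transpose (G x ** curv i j x) = 0"
proof -
  note sm = smooth_matrix
  have dd: "matrix_partial i (matrix_partial j G) x = transpose (matrix_partial i (conn j) x) ** G x
     + transpose (conn j x) ** matrix_partial i G x
     + (matrix_partial i G x ** conn j x + G x ** matrix_partial i (conn j) x)" for i j
  proof -
    have "matrix_partial i (matrix_partial j G) x = matrix_partial i (\<lambda>y. transpose (conn j y) ** G y + G y ** conn j y) x"
      by (rule matrix_partial_cong[OF open_W x matrix_partial_G])
    then show ?thesis
      by (simp only: matrix_partial_add matrix_partial_mult differentiable[OF _ x] sm matrix_partial_transpose)
  qed
  show ?thesis
    using matrix_partial_commute[OF open_W x smooth_G, of i j] unfolding dd matrix_partial_G[OF x]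
    by (simp add: curv_eq matrix_algebra transpose_G[OF x] algebra_simps)
qed

end

section \<open>The Riemann tensor and its Bianchi identities\<close>

lemma curvature_antisym: "curvature G i j k l x = - curvature G j i k l x"
  by (simp add: curvature_def sum_subtractf)

lemma partial_christoffel_commute: "x \<in> W \<Longrightarrow> partial i (\<Gamma> k j l) x = partial i (\<Gamma> k l j) x"
  by (rule partial_cong[OF open_W _ christoffel_commute])

text \<open>The value g(R(d_i, d_j) d_k, d_l). In this order of the indices the Ricci tensor
  contracts the first with the last.\<close>

definition riem :: "'m \<Rightarrow> 'm \<Rightarrow> 'm \<Rightarrow> 'm \<Rightarrow> real^'m \<Rightarrow> real" where
  "riem i j k l x = (\<Sum>q\<in>UNIV. G x $ l $ q * curvature G i j k q x)"

lemma smooth_riem: "smooth_on W (riem i j k l)"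
proof -
  have "smooth_on W (\<lambda>x. riem i j k l x)"
    unfolding riem_def
    by (intro smooth_on_sum smooth_on_mult open_W finite_class.finite_UNIV smooth_G smooth_curvature)
  then show ?thesis by simp
qed

lemma riem_eq: "riem i j k l x = (G x ** curv i j x) $ l $ k"
  by (simp add: riem_def curv_def matrix_matrix_mult_def)

lemma riem_antisym12: "riem i j k l x = - riem j i k l x"
  by (simp add: riem_def curvature_antisym[of i j] sum_negf)

lemma riem_antisym34: "x \<in> W \<Longrightarrow> riem i j k l x = - riem i j l k x"
  using arg_cong[OF curv_skew[of x i j], of "\<lambda>M. M $ l $ k"] by (simp add: riem_eq transpose_def)

text \<open>The covariant derivative of a 4-tensor in direction \<open>m\<close>. The indices are
  arguments of \<open>R\<close>, so \<open>riem\<close> with permuted indices can be inserted for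
  it.\<close>

definition nabla4 where
  "nabla4 R m i j k l x = partial m (R i j k l) x
     - (\<Sum>p\<in>UNIV. \<Gamma> p m i x * R p j k l x) - (\<Sum>p\<in>UNIV. \<Gamma> p m j x * R i p k l x)
     - (\<Sum>p\<in>UNIV. \<Gamma> p m k x * R i j p l x) - (\<Sum>p\<in>UNIV. \<Gamma> p m l x * R i j k p x)"

context
  fixes x assumes x: "x \<in> W"
begin

text \<open>Because the Christoffel symbols are symmetric, derivative terms and quadratic terms
  cancel in pairs in the cyclic sum.\<close>

lemma first_bianchi: "curvature G i j k l x + curvature G j k i l x + curvature G k i j l x = 0"
  using partial_christoffel_commute[OF x, of i l j k] partial_christoffel_commute[OF x, of j l i k]
    partial_christoffel_commute[OF x, of k l i j] christoffel_commute[OF x, of _ i j]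
    christoffel_commute[OF x, of _ i k] christoffel_commute[OF x, of _ j k]
  by (simp add: curvature_def sum_subtractf)

lemma sum_gi_riem: "(\<Sum>l\<in>UNIV. gi a l x * riem i j k l x) = curvature G i j k a x"
proof -
  have "(\<Sum>l\<in>UNIV. gi a l x * riem i j k l x)
     = (\<Sum>l\<in>UNIV. \<Sum>q\<in>UNIV. gi a l x * G x $ l $ q * curvature G i j k q x)"
    by (simp add: riem_def sum_distrib_left mult.assoc)
  also have "\<dots> = (\<Sum>q\<in>UNIV. (\<Sum>l\<in>UNIV. gi a l x * G x $ l $ q) * curvature G i j k q x)"
    by (subst sum.swap) (simp add: sum_distrib_right)
  also have "\<dots> = curvature G i j k a x"
    by (simp add: sum_gi_G[OF x] if_distrib if_distribR cong: if_cong)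
  finally show ?thesis .
qed

lemma ricci_eq: "ricci G x $ j $ k = (\<Sum>i\<in>UNIV. \<Sum>l\<in>UNIV. gi i l x * riem i j k l x)"
  by (simp add: sum_gi_riem ricci_def)

text \<open>The trace of a skew endomorphism: contracting the symmetric inverse metric with the
  antisymmetric pair of indices of \<open>riem\<close> yields a sum equal to its own
  negative.\<close>

lemma trace_curvature: "(\<Sum>a\<in>UNIV. curvature G i j a a x) = 0"
proof -
  let ?s = "\<Sum>a\<in>UNIV. \<Sum>l\<in>UNIV. gi a l x * riem i j a l x"
  have "?s = (\<Sum>l\<in>UNIV. \<Sum>a\<in>UNIV. gi a l x * riem i j a l x)" by (rule sum.swap)
  also have "\<dots> = (\<Sum>l\<in>UNIV. \<Sum>a\<in>UNIV. - (gi l a x * riem i j l a x))"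
  proof (intro sum.cong refl)
    fix a l
    show "gi a l x * riem i j a l x = - (gi l a x * riem i j l a x)"
      using gi_commute[OF x, of a l] riem_antisym34[OF x, of i j a l] by simp
  qed
  finally have "?s = - ?s" by (simp add: sum_negf)
  then show ?thesis by (simp add: sum_gi_riem)
qed

text \<open>Trace of the first Bianchi identity; its middle term is the trace of R(d_j, d_k), which
  vanishes, and the last is a Ricci component with opposite sign.\<close>

lemma ricci_commute: "ricci G x $ j $ k = ricci G x $ k $ j"
proof -
  have "(\<Sum>i\<in>UNIV. curvature G i j k i x + curvature G j k i i x + curvature G k i j i x) = 0"
    by (simp add: first_bianchi)
  moreover have "(\<Sum>i\<in>UNIV. curvature G k i j i x) = - (\<Sum>i\<in>UNIV. curvature G i k j i x)"
    by (simp add: curvature_antisym[of k] sum_negf)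
  ultimately show ?thesis by (simp add: ricci_def sum.distrib trace_curvature)
qed

end

context
  fixes x assumes x: "x \<in> W"
begin

text \<open>As \<open>G\<close> is parallel, it passes through the derivative of the endomorphism;
  this accounts for the corrections in \<open>k\<close> and \<open>l\<close> and leaves those in
  \<open>i\<close> and \<open>j\<close>.\<close>

lemma nabla4_curv:
  "nabla4 riem m i j k l x = (G x ** (matrix_partial m (curv i j) x + conn m x ** curv i j x - curv i j x ** conn m x)) $ l $ k
     - (\<Sum>p\<in>UNIV. \<Gamma> p m i x * riem p j k l x) - (\<Sum>p\<in>UNIV. \<Gamma> p m j x * riem i p k l x)"
proof -
  have "matrix_partial m (\<lambda>y. G y ** curv i j y) x = matrix_partial m G x ** curv i j x + G x ** matrix_partial m (curv i j) x"
    by (intro matrix_partial_mult differentiable[OF _ x] smooth_G smooth_curv)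
  then have "G x ** (matrix_partial m (curv i j) x + conn m x ** curv i j x - curv i j x ** conn m x)
    = matrix_partial m (\<lambda>y. G y ** curv i j y) x - transpose (conn m x) ** (G x ** curv i j x)
      - (G x ** curv i j x) ** conn m x"
    by (simp add: matrix_partial_G[OF x] matrix_algebra)
  moreover have "(transpose (conn m x) ** (G x ** curv i j x)) $ l $ k = (\<Sum>p\<in>UNIV. \<Gamma> p m l x * riem i j k p x)"
    unfolding riem_eq matrix_matrix_mult_def[of "transpose _"] by (simp add: transpose_def conn_def)
  moreover have "((G x ** curv i j x) ** conn m x) $ l $ k = (\<Sum>p\<in>UNIV. \<Gamma> p m k x * riem i j p l x)"
    unfolding riem_eq matrix_matrix_mult_def[of "_ ** _"] by (simp add: conn_def mult.commute)
  moreover have "matrix_partial m (\<lambda>y. G y ** curv i j y) x $ l $ k = partial m (riem i j k l) x"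
    by (simp add: matrix_partial_def riem_eq[abs_def])
  ultimately show ?thesis by (simp add: nabla4_def)
qed

lemma second_bianchi: "nabla4 riem m i j k l x + nabla4 riem i j m k l x + nabla4 riem j m i k l x = 0"
proof -
  let ?D = "\<lambda>m i j. matrix_partial m (curv i j) x + conn m x ** curv i j x - curv i j x ** conn m x"
  have "(G x ** ?D m i j) $ l $ k + (G x ** ?D i j m) $ l $ k + (G x ** ?D j m i) $ l $ k
    = (G x ** (?D m i j + ?D i j m + ?D j m i)) $ l $ k"
    by (simp only: matrix_add_ldistrib vector_add_component)
  also have "\<dots> = 0" by (simp add: bianchi_curv[OF x])
  finally have D: "(G x ** ?D m i j) $ l $ k + (G x ** ?D i j m) $ l $ k + (G x ** ?D j m i) $ l $ k = 0" .
  \<comment> \<open>Corrections in the first two indices cancel between different summands of the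
    cyclic sum: symmetric Christoffel symbols meet the antisymmetric pair of
    \<open>riem\<close>.\<close>
  have cancel: "(\<Sum>p\<in>UNIV. \<Gamma> p a b x * riem p c k l x) + (\<Sum>p\<in>UNIV. \<Gamma> p b a x * riem c p k l x) = 0" for a b c
    by (simp add: christoffel_commute[OF x, of _ a b] riem_antisym12[of _ c] sum_negf)
  show ?thesis
    using D cancel[of m i j] cancel[of i j m] cancel[of j m i] by (simp add: nabla4_curv)
qed

text \<open>Contraction of the first and last index commutes with covariant differentiation, by
  \<open>partial_contract\<close>; the corrections in \<open>j\<close> and \<open>k\<close> are
  carried along.\<close>

lemma contract_nabla4:
  assumes R: "\<And>i j k l. smooth_on W (R i j k l)"
    and T: "\<And>y j k. y \<in> W \<Longrightarrow> T y $ j $ k = (\<Sum>i\<in>UNIV. \<Sum>l\<in>UNIV. gi i l y * R i j k l y)"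
  shows "(\<Sum>i\<in>UNIV. \<Sum>l\<in>UNIV. gi i l x * nabla4 R m i j k l x) = nabla2 G T m j k x"
proof -
  have "partial m (\<lambda>y. T y $ j $ k) x = partial m (\<lambda>y. \<Sum>i\<in>UNIV. \<Sum>l\<in>UNIV. gi i l y * R i j k l y) x"
    by (rule partial_cong[OF open_W x T])
  also have "\<dots> = (\<Sum>i\<in>UNIV. \<Sum>l\<in>UNIV. gi i l x * (partial m (R i j k l) x
         - (\<Sum>p\<in>UNIV. \<Gamma> p m i x * R p j k l x) - (\<Sum>p\<in>UNIV. \<Gamma> p m l x * R i j k p x)))"
    by (rule partial_contract[OF x R])
  finally have d: "partial m (\<lambda>y. T y $ j $ k) x = \<dots>" .
  have pull: "(\<Sum>p\<in>UNIV. c p * (\<Sum>i\<in>UNIV. \<Sum>l\<in>UNIV. gi i l x * S p i l)) = (\<Sum>i\<in>UNIV. \<Sum>l\<in>UNIV. gi i l x * (\<Sum>p\<in>UNIV. c p * S p i l))"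
    for c :: "'m \<Rightarrow> real" and S :: "'m \<Rightarrow> 'm \<Rightarrow> 'm \<Rightarrow> real"
    by (simp add: sum_distrib_left mult.left_commute) (rule sum_rotate3[symmetric])
  show ?thesis
    unfolding nabla2_def d T[OF x] pull
    by (simp add: nabla4_def right_diff_distrib sum_subtractf)
qed

lemma nabla2_commute:
  assumes "\<And>y j k. y \<in> W \<Longrightarrow> T y $ j $ k = T y $ k $ j"
  shows "nabla2 G T i j k x = nabla2 G T i k j x"
  using partial_cong[OF open_W x, of "\<lambda>y. T y $ j $ k" "\<lambda>y. T y $ k $ j"] assms
  by (simp add: nabla2_def assms[OF x, of _ k] assms[OF x, of _ j])

lemma nabla4_antisym:
  assumes "\<And>y i j k l. y \<in> W \<Longrightarrow> R' i j k l y = - R i j k l y" and R: "\<And>i j k l. smooth_on W (R i j k l)"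
  shows "nabla4 R' m i j k l x = - nabla4 R m i j k l x"
proof -
  have "partial m (R' i j k l) x = partial m (\<lambda>y. (-1) * R i j k l y) x"
    by (rule partial_cong[OF open_W x]) (simp add: assms)
  also have "\<dots> = - partial m (R i j k l) x"
    by (subst partial_cmult) (simp_all add: differentiable[OF R x])
  finally show ?thesis
    by (simp add: nabla4_def assms(1)[OF x] sum_negf)
qed

text \<open>The second Bianchi identity is contracted with g^il g^jk. The first term gives the
  derivative of the scalar curvature, and each of the other two gives minus the divergence after one
  antisymmetry of \<open>riem\<close>; hence the factor 1/2.\<close>

lemma divergence_ricci: "divergence2 G (ricci G) m x = 1/2 * partial m (trace2 G (ricci G)) x"
proof -
  let ?N = "nabla2 G (ricci G)"
  let ?n = "nabla4 riem"
  have c: "(\<Sum>i\<in>UNIV. \<Sum>l\<in>UNIV. gi i l x * ?n m i j k l x) = ?N m j k x" for m j k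
    by (rule contract_nabla4[OF smooth_riem ricci_eq])
  have n1: "?n j m i k l x = - ?n j i m k l x" for j m i k l
  proof -
    have "nabla4 (\<lambda>i j k l. riem j i k l) j i m k l x = - ?n j i m k l x"
      by (rule nabla4_antisym[OF _ smooth_riem]) (rule riem_antisym12)
    then show ?thesis by (simp add: nabla4_def)
  qed
  have c1: "(\<Sum>i\<in>UNIV. \<Sum>l\<in>UNIV. gi i l x * ?n j m i k l x) = - ?N j m k x" for j m k
    unfolding c[symmetric] by (simp add: n1[of j m] sum_negf)
  have n2: "?n i j m k l x = - ?n i j m l k x" for i j m k l
  proof -
    have "nabla4 (\<lambda>i j k l. riem i j l k) i j m l k x = - ?n i j m l k x"
      by (rule nabla4_antisym[OF _ smooth_riem]) (rule riem_antisym34)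
    then show ?thesis by (simp add: nabla4_def)
  qed
  have c2: "(\<Sum>j\<in>UNIV. \<Sum>k\<in>UNIV. gi j k x * ?n i j m k l x) = - ?N i m l x" for i m l
    unfolding c[symmetric] by (simp add: n2[of i _ m _ l] sum_negf)
  have "0 = (\<Sum>j\<in>UNIV. \<Sum>k\<in>UNIV. gi j k x * (\<Sum>i\<in>UNIV. \<Sum>l\<in>UNIV. gi i l x *
      (?n m i j k l x + ?n i j m k l x + ?n j m i k l x)))"
    by (simp add: second_bianchi)
  also have "\<dots> = (\<Sum>j\<in>UNIV. \<Sum>k\<in>UNIV. gi j k x * ?N m j k x)
     + (\<Sum>j\<in>UNIV. \<Sum>k\<in>UNIV. gi j k x * (\<Sum>i\<in>UNIV. \<Sum>l\<in>UNIV. gi i l x * ?n i j m k l x))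
     - (\<Sum>j\<in>UNIV. \<Sum>k\<in>UNIV. gi j k x * ?N j m k x)"
    by (simp add: distrib_left right_diff_distrib sum.distrib sum_subtractf c c1)
  \<comment> \<open>Here \<open>i\<close> is the direction of differentiation and cannot be
    contracted as a tensor index, so the contraction over \<open>j\<close> and \<open>k\<close> has
    to be carried out first.\<close>
  also have "(\<Sum>j\<in>UNIV. \<Sum>k\<in>UNIV. gi j k x * (\<Sum>i\<in>UNIV. \<Sum>l\<in>UNIV. gi i l x * ?n i j m k l x))
     = (\<Sum>i\<in>UNIV. \<Sum>l\<in>UNIV. gi i l x * (\<Sum>j\<in>UNIV. \<Sum>k\<in>UNIV. gi j k x * ?n i j m k l x))"
  proof -
    have "(\<Sum>j\<in>UNIV. \<Sum>k\<in>UNIV. gi j k x * (\<Sum>i\<in>UNIV. \<Sum>l\<in>UNIV. gi i l x * ?n i j m k l x))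
      = (\<Sum>j\<in>UNIV. \<Sum>k\<in>UNIV. \<Sum>i\<in>UNIV. \<Sum>l\<in>UNIV. gi i l x * (gi j k x * ?n i j m k l x))"
      by (simp add: sum_distrib_left mult.left_commute)
    also have "\<dots> = (\<Sum>i\<in>UNIV. \<Sum>l\<in>UNIV. \<Sum>j\<in>UNIV. \<Sum>k\<in>UNIV. gi i l x * (gi j k x * ?n i j m k l x))"
      by (rule sum_swap_pairs)
    finally show ?thesis by (simp add: sum_distrib_left)
  qed
  also have "\<dots> = - (\<Sum>i\<in>UNIV. \<Sum>l\<in>UNIV. gi i l x * ?N i m l x)"
    by (simp add: c2 sum_negf)
  also have "(\<Sum>j\<in>UNIV. \<Sum>k\<in>UNIV. gi j k x * ?N m j k x) = partial m (trace2 G (ricci G)) x"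
    by (rule partial_trace2[OF x smooth_ricci, symmetric])
  also have "(\<Sum>i\<in>UNIV. \<Sum>l\<in>UNIV. gi i l x * ?N i m l x) = divergence2 G (ricci G) m x"
    unfolding divergence2_def by (simp add: nabla2_commute[of "ricci G" _ m, OF ricci_commute])
  finally show ?thesis by simp
qed

end

section \<open>Gradients, Hessians and the Bochner formula\<close>

context
  fixes x assumes x: "x \<in> W"
begin

lemma gradient_lower: "(\<Sum>j\<in>UNIV. G x $ i $ j * gradient G F x $ j) = partial i F x"
proof -
  have "(\<Sum>j\<in>UNIV. G x $ i $ j * gradient G F x $ j) = (\<Sum>j\<in>UNIV. \<Sum>l\<in>UNIV. G x $ i $ j * gi j l x * partial l F x)"
    by (simp add: gradient_def sum_distrib_left mult.assoc)
  also have "\<dots> = (\<Sum>l\<in>UNIV. (\<Sum>j\<in>UNIV. G x $ i $ j * gi j l x) * partial l F x)"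
    by (subst sum.swap) (simp add: sum_distrib_right)
  finally show ?thesis by (simp add: sum_G_gi[OF x] if_distrib if_distribR cong: if_cong)
qed

lemma apply2_gradients:
  "apply2 (G x) (gradient G F x) (gradient G K x) = (\<Sum>i\<in>UNIV. partial i F x * gradient G K x $ i)"
proof -
  have "apply2 (G x) (gradient G F x) (gradient G K x)
      = (\<Sum>i\<in>UNIV. gradient G F x $ i * (\<Sum>j\<in>UNIV. G x $ i $ j * gradient G K x $ j))"
    by (simp add: apply2_def sum_distrib_left mult_ac)
  also have "\<dots> = (\<Sum>i\<in>UNIV. \<Sum>j\<in>UNIV. gi i j x * partial j F x * partial i K x)"
    by (simp add: gradient_lower gradient_def[of G F] sum_distrib_right)
  also have "\<dots> = (\<Sum>j\<in>UNIV. \<Sum>i\<in>UNIV. gi i j x * partial j F x * partial i K x)"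
    by (rule sum.swap)
  also have "\<dots> = (\<Sum>i\<in>UNIV. partial i F x * gradient G K x $ i)"
    by (simp add: gradient_def sum_distrib_left gi_commute[OF x] mult_ac)
  finally show ?thesis .
qed

text \<open>The form of the inner product of gradients to which \<open>partial_contract\<close>
  applies.\<close>

lemma apply2_gradients':
  "apply2 (G x) (gradient G F x) (gradient G K x) = (\<Sum>a\<in>UNIV. \<Sum>b\<in>UNIV. gi a b x * (partial a F x * partial b K x))"
  by (simp add: apply2_gradients) (simp add: gradient_def sum_distrib_left mult_ac)

lemma hessian_commute:
  assumes F: "smooth_on W F"
  shows "hessian G F x $ i $ j = hessian G F x $ j $ i"
  using partial_commute[OF open_W x F, of i j] by (simp add: hessian_def christoffel_commute[OF x, of _ i j])

lemma partial_hessian: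
  assumes F: "smooth_on W F"
  shows "partial i (\<lambda>y. hessian G F y $ j $ k) x = partial i (partial j (partial k F)) x
    - (\<Sum>l\<in>UNIV. partial i (\<Gamma> l j k) x * partial l F x + \<Gamma> l j k x * partial i (partial l F) x)"
proof -
  note D = differentiable[OF _ x] smooth_on_partial[OF F] smooth_on_partial[OF smooth_on_partial[OF F]]
    smooth_christoffel smooth_on_sum[OF open_W finite_class.finite_UNIV] smooth_on_mult[OF open_W]
  have "partial i (\<lambda>y. hessian G F y $ j $ k) x
     = partial i (\<lambda>y. partial j (partial k F) y - (\<Sum>l\<in>UNIV. \<Gamma> l j k y * partial l F y)) x"
    by (simp add: hessian_def)
  also have "\<dots> = partial i (partial j (partial k F)) x - partial i (\<lambda>y. \<Sum>l\<in>UNIV. \<Gamma> l j k y * partial l F y) x"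
    by (intro partial_diff D)
  also have "partial i (\<lambda>y. \<Sum>l\<in>UNIV. \<Gamma> l j k y * partial l F y) x = (\<Sum>l\<in>UNIV. partial i (\<lambda>y. \<Gamma> l j k y * partial l F y) x)"
    by (intro partial_sum D)
  also have "\<dots> = (\<Sum>l\<in>UNIV. partial i (\<Gamma> l j k) x * partial l F x + \<Gamma> l j k x * partial i (partial l F) x)"
    by (intro sum.cong refl partial_mult D)
  finally show ?thesis .
qed

text \<open>Covariant derivatives of the one-form dF are commuted; the minus sign is that of the
  curvature acting on covectors. Third partial derivatives and the terms with symbols in
  \<open>i j\<close> agree on both sides, and the rest is the definition of curvature.\<close>

lemma ricci_identity:
  assumes F: "smooth_on W F"
  shows "nabla2 G (hessian G F) i j k x = nabla2 G (hessian G F) j i k x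
     - (\<Sum>l\<in>UNIV. curvature G i j k l x * partial l F x)"
proof -
  have h: "(\<Sum>p\<in>UNIV. \<Gamma> p i k x * hessian G F x $ j $ p)
     = (\<Sum>p\<in>UNIV. \<Gamma> p i k x * partial j (partial p F) x)
       - (\<Sum>l\<in>UNIV. \<Sum>p\<in>UNIV. \<Gamma> p i k x * \<Gamma> l j p x * partial l F x)" for i j
  proof -
    have "(\<Sum>p\<in>UNIV. \<Sum>l\<in>UNIV. \<Gamma> p i k x * \<Gamma> l j p x * partial l F x)
      = (\<Sum>l\<in>UNIV. \<Sum>p\<in>UNIV. \<Gamma> p i k x * \<Gamma> l j p x * partial l F x)" by (rule sum.swap)
    then show ?thesis
      by (simp add: hessian_def right_diff_distrib sum_subtractf sum_distrib_left mult.assoc)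
  qed
  have "partial i (partial j (partial k F)) x = partial j (partial i (partial k F)) x"
    by (rule partial_commute[OF open_W x smooth_on_partial[OF F]])
  moreover have "(\<Sum>l\<in>UNIV. curvature G i j k l x * partial l F x)
     = (\<Sum>l\<in>UNIV. partial i (\<Gamma> l j k) x * partial l F x) - (\<Sum>l\<in>UNIV. partial j (\<Gamma> l i k) x * partial l F x)
     + (\<Sum>l\<in>UNIV. \<Sum>p\<in>UNIV. \<Gamma> p j k x * \<Gamma> l i p x * partial l F x)
     - (\<Sum>l\<in>UNIV. \<Sum>p\<in>UNIV. \<Gamma> p i k x * \<Gamma> l j p x * partial l F x)"
    by (simp add: curvature_def distrib_right left_diff_distrib sum.distrib sum_subtractf sum_distrib_right)
  ultimately show ?thesis
    by (simp add: nabla2_def partial_hessian[OF F] h sum.distrib christoffel_commute[OF x, of _ i j])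
qed

end

context
  fixes x assumes x: "x \<in> W"
begin

text \<open>The symmetry of the Hessian brings \<open>k\<close> next to the derivative, the Ricci
  identity exchanges it with \<open>i\<close>, and the trace of the first term is then the
  derivative of the Laplacian.\<close>

lemma divergence_hessian:
  assumes F: "smooth_on W F"
  shows "divergence2 G (hessian G F) k x = partial k (laplacian G F) x
     + (\<Sum>a\<in>UNIV. ricci G x $ k $ a * gradient G F x $ a)"
proof -
  let ?H = "nabla2 G (hessian G F)"
  \<comment> \<open>Swapping the last two indices of \<open>riem\<close> produces the Ricci
    contraction; its sign cancels the one in \<open>ricci_identity\<close>.\<close>
  have c: "(\<Sum>i\<in>UNIV. \<Sum>j\<in>UNIV. gi i j x * curvature G i k j l x) = - (\<Sum>a\<in>UNIV. gi l a x * ricci G x $ k $ a)" for l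
  proof -
    have "(\<Sum>i\<in>UNIV. \<Sum>j\<in>UNIV. gi i j x * curvature G i k j l x)
       = (\<Sum>i\<in>UNIV. \<Sum>j\<in>UNIV. \<Sum>a\<in>UNIV. gi i j x * (gi l a x * riem i k j a x))"
      by (simp add: sum_gi_riem[OF x, of l, symmetric] sum_distrib_left)
    also have "\<dots> = (\<Sum>a\<in>UNIV. \<Sum>i\<in>UNIV. \<Sum>j\<in>UNIV. gi i j x * (gi l a x * riem i k j a x))"
      by (rule sum_rotate3)
    also have "\<dots> = (\<Sum>a\<in>UNIV. \<Sum>i\<in>UNIV. \<Sum>j\<in>UNIV. gi i j x * (gi l a x * (- riem i k a j x)))"
      by (intro sum.cong refl arg_cong2[of _ _ _ _ "(*)"] riem_antisym34 x)
    also have "\<dots> = - (\<Sum>a\<in>UNIV. gi l a x * (\<Sum>i\<in>UNIV. \<Sum>j\<in>UNIV. gi i j x * riem i k a j x))"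
      by (simp add: sum_distrib_left sum_negf mult_ac)
    finally show ?thesis by (simp add: ricci_eq[OF x])
  qed
  have "divergence2 G (hessian G F) k x = (\<Sum>i\<in>UNIV. \<Sum>j\<in>UNIV. gi i j x * ?H i k j x)"
    unfolding divergence2_def by (simp add: nabla2_commute[OF x hessian_commute[OF _ F], of _ _ k])
  also have "\<dots> = (\<Sum>i\<in>UNIV. \<Sum>j\<in>UNIV. gi i j x * ?H k i j x)
     - (\<Sum>i\<in>UNIV. \<Sum>j\<in>UNIV. \<Sum>l\<in>UNIV. gi i j x * (curvature G i k j l x * partial l F x))"
    by (simp add: ricci_identity[OF x F, of _ k] right_diff_distrib sum_subtractf sum_distrib_left)
  also have "(\<Sum>i\<in>UNIV. \<Sum>j\<in>UNIV. gi i j x * ?H k i j x) = partial k (laplacian G F) x"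
    unfolding laplacian_def by (rule partial_trace2[OF x smooth_hessian[OF F], symmetric])
  also have "(\<Sum>i\<in>UNIV. \<Sum>j\<in>UNIV. \<Sum>l\<in>UNIV. gi i j x * (curvature G i k j l x * partial l F x))
     = (\<Sum>l\<in>UNIV. (\<Sum>i\<in>UNIV. \<Sum>j\<in>UNIV. gi i j x * curvature G i k j l x) * partial l F x)"
    by (subst sum_rotate3) (simp only: sum_distrib_right mult.assoc)
  also have "\<dots> = - (\<Sum>l\<in>UNIV. \<Sum>a\<in>UNIV. gi l a x * ricci G x $ k $ a * partial l F x)"
    by (simp add: c sum_negf sum_distrib_right)
  also have "(\<Sum>l\<in>UNIV. \<Sum>a\<in>UNIV. gi l a x * ricci G x $ k $ a * partial l F x)
     = (\<Sum>a\<in>UNIV. ricci G x $ k $ a * gradient G F x $ a)"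
    by (subst sum.swap) (simp add: gradient_def sum_distrib_left gi_commute[OF x] mult_ac)
  finally show ?thesis by simp
qed

text \<open>The two terms of the product rule agree by symmetry of the inverse metric. The
  contraction is left written out because \<open>hessian_norm_gradient\<close> differentiates it
  once more by \<open>partial_contract\<close>.\<close>

lemma partial_norm_gradient:
  assumes F: "smooth_on W F"
  shows "partial k (\<lambda>y. apply2 (G y) (gradient G F y) (gradient G F y)) x
     = 2 * (\<Sum>a\<in>UNIV. \<Sum>b\<in>UNIV. gi a b x * (hessian G F x $ k $ a * partial b F x))"
proof -
  have sm: "smooth_on W (\<lambda>y. partial a F y * partial b F y)" for a b
    by (intro smooth_on_mult open_W smooth_on_partial F)
  have d: "partial k (\<lambda>y. partial a F y * partial b F y) x
     = partial k (partial a F) x * partial b F x + partial a F x * partial k (partial b F) x" for a b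
    by (intro partial_mult differentiable[OF _ x] smooth_on_partial F)
  have "partial k (\<lambda>y. apply2 (G y) (gradient G F y) (gradient G F y)) x
     = partial k (\<lambda>y. \<Sum>a\<in>UNIV. \<Sum>b\<in>UNIV. gi a b y * (partial a F y * partial b F y)) x"
    by (rule partial_cong[OF open_W x]) (rule apply2_gradients')
  also have "\<dots> = (\<Sum>a\<in>UNIV. \<Sum>b\<in>UNIV. gi a b x * (partial k (\<lambda>y. partial a F y * partial b F y) x
         - (\<Sum>p\<in>UNIV. \<Gamma> p k a x * (partial p F x * partial b F x))
         - (\<Sum>p\<in>UNIV. \<Gamma> p k b x * (partial a F x * partial p F x))))"
    by (rule partial_contract[OF x sm])
  also have "\<dots> = (\<Sum>a\<in>UNIV. \<Sum>b\<in>UNIV. gi a b x * (hessian G F x $ k $ a * partial b F x))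
     + (\<Sum>a\<in>UNIV. \<Sum>b\<in>UNIV. gi a b x * (hessian G F x $ k $ b * partial a F x))"
    by (simp add: d hessian_def algebra_simps sum.distrib sum_subtractf sum_distrib_left)
  also have "(\<Sum>a\<in>UNIV. \<Sum>b\<in>UNIV. gi a b x * (hessian G F x $ k $ b * partial a F x))
     = (\<Sum>a\<in>UNIV. \<Sum>b\<in>UNIV. gi a b x * (hessian G F x $ k $ a * partial b F x))"
    by (subst sum.swap) (simp add: gi_commute[OF x])
  finally show ?thesis by simp
qed

end

context
  fixes x assumes x: "x \<in> W"
begin

lemma hessian_norm_gradient:
  assumes F: "smooth_on W F"
  shows "hessian G (\<lambda>y. apply2 (G y) (gradient G F y) (gradient G F y)) x $ i $ j
     = 2 * (\<Sum>a\<in>UNIV. \<Sum>b\<in>UNIV. gi a b x * (nabla2 G (hessian G F) i j a x * partial b F x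
          + hessian G F x $ j $ a * hessian G F x $ i $ b))"
proof -
  let ?q = "\<lambda>y. apply2 (G y) (gradient G F y) (gradient G F y)"
  let ?T = "\<lambda>k y. \<Sum>a\<in>UNIV. \<Sum>b\<in>UNIV. gi a b y * (hessian G F y $ k $ a * partial b F y)"
  have sm: "smooth_on W (\<lambda>y. hessian G F y $ j $ a * partial b F y)" for a b
    by (intro smooth_on_mult open_W smooth_on_partial F smooth_hessian)
  have d: "partial i (\<lambda>y. hessian G F y $ j $ a * partial b F y) x
     = partial i (\<lambda>y. hessian G F y $ j $ a) x * partial b F x + hessian G F x $ j $ a * partial i (partial b F) x" for a b
    by (intro partial_mult differentiable[OF _ x] smooth_on_partial F smooth_hessian)
  have smT: "smooth_on W (?T j)"
    by (intro smooth_on_sum open_W finite_class.finite_UNIV smooth_on_mult smooth_gi sm)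
  have "partial i (partial j ?q) x = partial i (\<lambda>y. 2 * ?T j y) x"
    by (rule partial_cong[OF open_W x]) (rule partial_norm_gradient[OF _ F])
  also have "\<dots> = 2 * partial i (?T j) x"
    by (rule partial_cmult[OF differentiable[OF smT x]])
  also have "partial i (?T j) x = (\<Sum>a\<in>UNIV. \<Sum>b\<in>UNIV. gi a b x * (partial i (\<lambda>y. hessian G F y $ j $ a * partial b F y) x
         - (\<Sum>p\<in>UNIV. \<Gamma> p i a x * (hessian G F x $ j $ p * partial b F x))
         - (\<Sum>p\<in>UNIV. \<Gamma> p i b x * (hessian G F x $ j $ a * partial p F x))))"
    by (rule partial_contract[OF x sm])
  also have "\<dots> = (\<Sum>a\<in>UNIV. \<Sum>b\<in>UNIV. gi a b x * ((partial i (\<lambda>y. hessian G F y $ j $ a) x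
      - (\<Sum>p\<in>UNIV. \<Gamma> p i a x * hessian G F x $ j $ p)) * partial b F x
          + hessian G F x $ j $ a * hessian G F x $ i $ b))"
  proof (intro sum.cong refl arg_cong2[of _ _ _ _ "(*)"])
    fix a b
    have e1: "(\<Sum>p\<in>UNIV. \<Gamma> p i b x * (hessian G F x $ j $ a * partial p F x)) = hessian G F x $ j $ a * (\<Sum>p\<in>UNIV. \<Gamma> p i b x * partial p F x)"
      by (simp add: sum_distrib_left mult_ac)
    have e2: "(\<Sum>p\<in>UNIV. \<Gamma> p i a x * (hessian G F x $ j $ p * partial b F x)) = (\<Sum>p\<in>UNIV. \<Gamma> p i a x * hessian G F x $ j $ p) * partial b F x"
      by (simp only: sum_distrib_right mult.assoc)
    have e3: "hessian G F x $ i $ b = partial i (partial b F) x - (\<Sum>p\<in>UNIV. \<Gamma> p i b x * partial p F x)"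
      by (simp add: hessian_def)
    show "partial i (\<lambda>y. hessian G F y $ j $ a * partial b F y) x
         - (\<Sum>p\<in>UNIV. \<Gamma> p i a x * (hessian G F x $ j $ p * partial b F x))
         - (\<Sum>p\<in>UNIV. \<Gamma> p i b x * (hessian G F x $ j $ a * partial p F x))
       = (partial i (\<lambda>y. hessian G F y $ j $ a) x
      - (\<Sum>p\<in>UNIV. \<Gamma> p i a x * hessian G F x $ j $ p)) * partial b F x
          + hessian G F x $ j $ a * hessian G F x $ i $ b"
      unfolding d e1 e2 e3 by (simp add: left_diff_distrib right_diff_distrib)
  qed
  \<comment> \<open>What is missing for a full covariant derivative is the correction in the index
    \<open>j\<close>. Adding it costs the last sum, which is half of what the Hessian of the squared
    norm subtracts.\<close>
  also have "\<dots> = (\<Sum>a\<in>UNIV. \<Sum>b\<in>UNIV. gi a b x * (nabla2 G (hessian G F) i j a x * partial b F x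
          + hessian G F x $ j $ a * hessian G F x $ i $ b))
     + (\<Sum>p\<in>UNIV. \<Gamma> p i j x * ?T p x)"
  proof -
    have "(\<Sum>p\<in>UNIV. \<Gamma> p i j x * ?T p x) = (\<Sum>p\<in>UNIV. \<Sum>a\<in>UNIV. \<Sum>b\<in>UNIV. gi a b x * (\<Gamma> p i j x * hessian G F x $ p $ a * partial b F x))"
      by (simp add: sum_distrib_left mult_ac)
    also have "\<dots> = (\<Sum>a\<in>UNIV. \<Sum>b\<in>UNIV. \<Sum>p\<in>UNIV. gi a b x * (\<Gamma> p i j x * hessian G F x $ p $ a * partial b F x))"
      by (rule sum_rotate3[symmetric])
    also have "\<dots> = (\<Sum>a\<in>UNIV. \<Sum>b\<in>UNIV. gi a b x * ((\<Sum>p\<in>UNIV. \<Gamma> p i j x * hessian G F x $ p $ a) * partial b F x))"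
      by (simp add: sum_distrib_left sum_distrib_right)
    finally have e: "(\<Sum>p\<in>UNIV. \<Gamma> p i j x * ?T p x) = \<dots>" .
    show ?thesis
      unfolding e sum.distrib[symmetric] by (intro sum.cong refl) (simp add: nabla2_def algebra_simps)
  qed
  finally show ?thesis
    by (simp add: hessian_def[of G ?q] partial_norm_gradient[OF x F] sum_distrib_left algebra_simps)
qed

text \<open>The trace of \<open>hessian_norm_gradient\<close>. The divergence of the Hessian is not
  resolved into Ricci terms, since the soliton equation supplies it directly.\<close>

lemma laplacian_norm_gradient:
  assumes F: "smooth_on W F"
  shows "1/2 * laplacian G (\<lambda>y. apply2 (G y) (gradient G F y) (gradient G F y)) x
     = norm2_squared G (hessian G F) x
       + (\<Sum>k\<in>UNIV. divergence2 G (hessian G F) k x * gradient G F x $ k)"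
proof -
  let ?H = "hessian G F x" and ?N = "nabla2 G (hessian G F)"
  have "1/2 * laplacian G (\<lambda>y. apply2 (G y) (gradient G F y) (gradient G F y)) x
     = (\<Sum>i\<in>UNIV. \<Sum>j\<in>UNIV. gi i j x * (\<Sum>a\<in>UNIV. \<Sum>b\<in>UNIV. gi a b x * (?N i j a x * partial b F x + ?H $ j $ a * ?H $ i $ b)))"
    by (simp add: laplacian_def trace2_def hessian_norm_gradient[OF F] sum_distrib_left[symmetric] mult.left_commute[of _ 2])
  also have "\<dots> = (\<Sum>i\<in>UNIV. \<Sum>j\<in>UNIV. gi i j x * (\<Sum>a\<in>UNIV. ?N i j a x * gradient G F x $ a))
     + (\<Sum>i\<in>UNIV. \<Sum>j\<in>UNIV. gi i j x * (\<Sum>a\<in>UNIV. \<Sum>b\<in>UNIV. gi a b x * (?H $ j $ a * ?H $ i $ b)))"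
    by (simp add: gradient_def distrib_left sum.distrib sum_distrib_left mult_ac)
  also have "(\<Sum>i\<in>UNIV. \<Sum>j\<in>UNIV. gi i j x * (\<Sum>a\<in>UNIV. ?N i j a x * gradient G F x $ a))
     = (\<Sum>k\<in>UNIV. divergence2 G (hessian G F) k x * gradient G F x $ k)"
  proof -
    have "(\<Sum>i\<in>UNIV. \<Sum>j\<in>UNIV. gi i j x * (\<Sum>a\<in>UNIV. ?N i j a x * gradient G F x $ a))
      = (\<Sum>i\<in>UNIV. \<Sum>j\<in>UNIV. \<Sum>a\<in>UNIV. gi i j x * ?N i j a x * gradient G F x $ a)"
      by (simp add: sum_distrib_left mult_ac)
    also have "\<dots> = (\<Sum>a\<in>UNIV. \<Sum>i\<in>UNIV. \<Sum>j\<in>UNIV. gi i j x * ?N i j a x * gradient G F x $ a)"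
      by (rule sum_rotate3)
    finally show ?thesis by (simp add: divergence2_def sum_distrib_right)
  qed
  also have "(\<Sum>i\<in>UNIV. \<Sum>j\<in>UNIV. gi i j x * (\<Sum>a\<in>UNIV. \<Sum>b\<in>UNIV. gi a b x * (?H $ j $ a * ?H $ i $ b)))
     = norm2_squared G (hessian G F) x"
  proof -
    have "norm2_squared G (hessian G F) x
      = (\<Sum>i\<in>UNIV. \<Sum>b\<in>UNIV. \<Sum>j\<in>UNIV. \<Sum>a\<in>UNIV. gi i j x * (gi b a x * (?H $ i $ b * ?H $ j $ a)))"
      by (simp add: norm2_squared_def mult_ac)
    also have "\<dots> = (\<Sum>i\<in>UNIV. \<Sum>j\<in>UNIV. \<Sum>b\<in>UNIV. \<Sum>a\<in>UNIV. gi i j x * (gi b a x * (?H $ i $ b * ?H $ j $ a)))"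
      by (rule sum.cong[OF refl], rule sum.swap)
    also have "\<dots> = (\<Sum>i\<in>UNIV. \<Sum>j\<in>UNIV. \<Sum>a\<in>UNIV. \<Sum>b\<in>UNIV. gi i j x * (gi b a x * (?H $ i $ b * ?H $ j $ a)))"
      by (rule sum.cong[OF refl], rule sum.cong[OF refl], rule sum.swap)
    finally show ?thesis by (simp add: sum_distrib_left gi_commute[OF x] mult_ac)
  qed
  finally show ?thesis by simp
qed

end
end

section \<open>Pullback metrics and the tension field\<close>

lemma apply2_inner: "apply2 T v w = inner v (T *v w)"
  by (simp add: apply2_def inner_vec_def matrix_vector_mult_def sum_distrib_left mult_ac)

lemma apply2_add_left: "apply2 T (v + v') w = apply2 T v w + apply2 T v' w"
  and apply2_diff_left: "apply2 T (v - v') w = apply2 T v w - apply2 T v' w"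
  and apply2_scale_left: "apply2 T (c *\<^sub>R v) w = c * apply2 T v w"
  by (simp_all add: apply2_inner inner_add_left inner_diff_left)

lemma apply2_add_right: "apply2 T v (w + w') = apply2 T v w + apply2 T v w'"
  and apply2_diff_right: "apply2 T v (w - w') = apply2 T v w - apply2 T v w'"
  and apply2_scale_right: "apply2 T v (c *\<^sub>R w) = c * apply2 T v w"
  by (simp_all add: apply2_inner matrix_vector_right_distrib matrix_vector_mult_diff_distrib
      matrix_vector_mult_scaleR inner_add_right inner_diff_right)

lemma apply2_sum_left: "apply2 T (\<Sum>s\<in>S. v s) w = (\<Sum>s\<in>S. apply2 T (v s) w)"
  by (simp add: apply2_inner inner_sum_left)

lemma apply2_sum_right: "apply2 T v (\<Sum>s\<in>S. w s) = (\<Sum>s\<in>S. apply2 T v (w s))"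
  by (simp add: apply2_inner linear_sum[OF matrix_vector_mul_linear] inner_sum_right)

lemmas apply2_bilinear = apply2_add_left apply2_diff_left apply2_scale_left apply2_sum_left
  apply2_add_right apply2_diff_right apply2_scale_right apply2_sum_right

lemma apply2_commute: "(\<And>i j. T $ i $ j = T $ j $ i) \<Longrightarrow> apply2 T v w = apply2 T w v"
  unfolding apply2_def by (subst sum.swap) (simp add: mult_ac)

lemma apply2_axis: "apply2 T v (axis k 1) = (\<Sum>a\<in>UNIV. T $ a $ k * v $ a)"
  by (simp add: apply2_def axis_def if_distrib cong: if_cong)

lemma apply2_add_matrix: "apply2 (S + T) v w = apply2 S v w + apply2 T v w"
  by (simp add: apply2_inner matrix_vector_mult_add_rdistrib inner_add_right)

lemma apply2_mult_right: "apply2 (T ** A) v w = apply2 T v (A *v w)"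
  by (simp add: apply2_inner matrix_vector_mul_assoc)

lemma apply2_mult_left: "apply2 (transpose A ** T) v w = apply2 T (A *v v) w"
  by (simp add: apply2_inner matrix_vector_mul_assoc[symmetric] inner_commute[of v] dot_lmul_matrix)
    (rule inner_commute)

text \<open>In this locale \<open>du i\<close> is du(d_i) in target components,
  \<open>ddu i j\<close> is the second fundamental form of the map on d_i and d_j, and
  \<open>pull\<close> is the pullback metric.\<close>

locale map_coordinates = metric_coordinates W G + tgt: metric_coordinates V H
  for W :: "(real^'m::finite) set" and G :: "'m field2"
    and V :: "(real^'n::finite) set" and H :: "'n field2" +
  fixes U :: "real^'m \<Rightarrow> real^'n"
  assumes U_in: "U ` W \<subseteq> V" and smooth_U: "\<And>a. smooth_on W (\<lambda>y. U y $ a)"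
begin

definition du :: "'m \<Rightarrow> real^'m \<Rightarrow> real^'n" where
  "du i y = (\<chi> a. partial i (\<lambda>z. U z $ a) y)"

definition ddu :: "'m \<Rightarrow> 'm \<Rightarrow> real^'m \<Rightarrow> real^'n" where
  "ddu i j y = (\<chi> a. nabla_du G H U a i j y)"

definition pull :: "'m field2" where
  "pull y = (\<chi> i j. apply2 (H (U y)) (du i y) (du j y))"

lemma smooth_H_U: "smooth_on W (\<lambda>y. H (U y) $ a $ b)"
  by (rule smooth_on_compose[OF open_W tgt.open_W U_in tgt.smooth_G smooth_U])

lemma smooth_du: "smooth_on W (\<lambda>y. du i y $ a)"
  by (simp add: du_def smooth_on_partial smooth_U)

lemma smooth_pull: "smooth_on W (\<lambda>y. pull y $ i $ j)"
  unfolding pull_def apply2_def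
  by (simp, intro smooth_on_sum smooth_on_mult open_W finite_class.finite_UNIV smooth_H_U smooth_du)

context
  fixes x assumes x: "x \<in> W"
begin

lemma U_x: "U x \<in> V"
  using x U_in by auto

lemma apply2_H_commute: "apply2 (H (U x)) v w = apply2 (H (U x)) w v"
  by (rule apply2_commute) (rule tgt.sym_G[OF U_x])

lemma pull_commute: "pull x $ i $ j = pull x $ j $ i"
  by (simp add: pull_def) (rule apply2_H_commute)

text \<open>The target metric is parallel along the map: \<open>A i\<close> is the matrix, in
  direction \<open>i\<close>, of the connection pulled back to the bundle u^*TN.\<close>

lemma partial_H_U:
  defines "A i \<equiv> \<chi> a e. \<Sum>b\<in>UNIV. christoffel H a b e (U x) * du i x $ b"
  shows "(\<chi> a b. partial i (\<lambda>y. H (U y) $ a $ b) x) = transpose (A i) ** H (U x) + H (U x) ** A i"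
proof -
  have "partial i (\<lambda>y. H (U y) $ a $ b) x = (transpose (A i) ** H (U x) + H (U x) ** A i) $ a $ b" for a b
  proof -
    have "partial i (\<lambda>y. H (U y) $ a $ b) x = (\<Sum>c\<in>UNIV. du i x $ c * partial c (\<lambda>z. H z $ a $ b) (U x))"
      using compose_derivative(2)[OF tgt.differentiable[OF tgt.smooth_G U_x] differentiable[OF smooth_U x]]
      by (simp add: du_def)
    also have "\<dots> = (\<Sum>c\<in>UNIV. \<Sum>p\<in>UNIV. christoffel H p c a (U x) * du i x $ c * H (U x) $ p $ b)
       + (\<Sum>c\<in>UNIV. \<Sum>p\<in>UNIV. H (U x) $ a $ p * (christoffel H p c b (U x) * du i x $ c))"
      by (simp add: tgt.metric_compatible[OF U_x] distrib_left sum.distrib sum_distrib_left mult_ac)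
    also have "(\<Sum>c\<in>UNIV. \<Sum>p\<in>UNIV. christoffel H p c a (U x) * du i x $ c * H (U x) $ p $ b)
       = (transpose (A i) ** H (U x)) $ a $ b"
      by (subst sum.swap) (simp add: A_def transpose_def matrix_matrix_mult_def sum_distrib_right)
    also have "(\<Sum>c\<in>UNIV. \<Sum>p\<in>UNIV. H (U x) $ a $ p * (christoffel H p c b (U x) * du i x $ c))
       = (H (U x) ** A i) $ a $ b"
      by (subst sum.swap) (simp add: A_def matrix_matrix_mult_def sum_distrib_left)
    finally show ?thesis by simp
  qed
  then show ?thesis by (simp add: vec_eq_iff)
qed

text \<open>Presents \<open>ddu\<close> as a covariant derivative of the section \<open>du j\<close>
  of u^*TN, with the same matrix \<open>A i\<close> as in \<open>partial_H_U\<close>, so that the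
  two can be combined.\<close>

lemma ddu_eq:
  defines "A i \<equiv> \<chi> a e. \<Sum>b\<in>UNIV. christoffel H a b e (U x) * du i x $ b"
  shows "ddu i j x = (\<chi> a. partial i (\<lambda>y. du j y $ a) x) - (\<Sum>k\<in>UNIV. \<Gamma> k i j x *\<^sub>R du k x) + A i *v du j x"
proof -
  have "(\<Sum>b\<in>UNIV. \<Sum>e\<in>UNIV. christoffel H a b e (U x) * du i x $ b * du j x $ e)
     = (\<Sum>e\<in>UNIV. \<Sum>b\<in>UNIV. christoffel H a b e (U x) * du i x $ b * du j x $ e)" for a
    by (rule sum.swap)
  then show ?thesis
    by (simp add: vec_eq_iff ddu_def nabla_du_def A_def matrix_vector_mult_def sum_distrib_right)
      (simp add: du_def)
qed

text \<open>Both Levi-Civita connections are torsion free.\<close>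

lemma ddu_commute: "ddu i j x = ddu j i x"
proof -
  have s: "(\<Sum>b\<in>UNIV. \<Sum>e\<in>UNIV. christoffel H a b e (U x) * p b * q e)
     = (\<Sum>b\<in>UNIV. \<Sum>e\<in>UNIV. christoffel H a b e (U x) * q b * p e)" for a p q
    by (subst sum.swap, intro sum.cong refl) (simp add: tgt.christoffel_commute[OF U_x])
  show ?thesis
    unfolding ddu_def nabla_du_def vec_eq_iff
    using partial_commute[OF open_W x smooth_U, of i j] christoffel_commute[OF x, of _ i j]
      s[of _ "\<lambda>b. partial i (\<lambda>y. U y $ b) x" "\<lambda>b. partial j (\<lambda>y. U y $ b) x"] by simp
qed

text \<open>Product rule for h(du_j, du_k): the derivative of the target metric supplies the terms
  with \<open>A i\<close>, and \<open>nabla2\<close> those with source Christoffel symbols, which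
  together complete the derivatives of \<open>du\<close> to \<open>ddu\<close>.\<close>

lemma nabla2_pull:
  "nabla2 G pull i j k x = apply2 (H (U x)) (ddu i j x) (du k x) + apply2 (H (U x)) (du j x) (ddu i k x)"
proof -
  define A where "A i = (\<chi> a e. \<Sum>b\<in>UNIV. christoffel H a b e (U x) * du i x $ b)" for i
  let ?d = "\<lambda>j. \<chi> a. partial i (\<lambda>y. du j y $ a) x"
  note D = differentiable[OF smooth_du x] differentiable[OF smooth_H_U x]
  have "partial i (\<lambda>y. pull y $ j $ k) x
     = partial i (\<lambda>y. \<Sum>a\<in>UNIV. \<Sum>b\<in>UNIV. H (U y) $ a $ b * du j y $ a * du k y $ b) x"
    by (simp add: pull_def apply2_def)
  also have "\<dots> = apply2 (\<chi> a b. partial i (\<lambda>y. H (U y) $ a $ b) x) (du j x) (du k x)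
     + apply2 (H (U x)) (?d j) (du k x) + apply2 (H (U x)) (du j x) (?d k)"
    using D by (simp add: partial_sum partial_mult apply2_def sum.distrib distrib_right)
  also have "\<dots> = apply2 (H (U x)) (A i *v du j x) (du k x) + apply2 (H (U x)) (du j x) (A i *v du k x)
     + apply2 (H (U x)) (?d j) (du k x) + apply2 (H (U x)) (du j x) (?d k)"
    unfolding partial_H_U A_def[symmetric] by (simp add: apply2_add_matrix apply2_mult_left[of "A i"] apply2_mult_right[of "H (U x)"])
  finally show ?thesis
    by (simp add: nabla2_def ddu_eq A_def[symmetric] apply2_bilinear) (simp add: pull_def)
qed

lemma tension_eq: "tension_comp G H U x = (\<Sum>i\<in>UNIV. \<Sum>j\<in>UNIV. gi i j x *\<^sub>R ddu i j x)"
  by (simp add: vec_eq_iff tension_comp_def ddu_def)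

lemma divergence_pull:
  "divergence2 G pull k x = apply2 (H (U x)) (tension_comp G H U x) (du k x) + 1/2 * partial k (trace2 G pull) x"
proof -
  \<comment> \<open>Half of the derivative of |du|^2 in direction \<open>k\<close>. It also appears
    in the divergence, because \<open>ddu\<close> is symmetric.\<close>
  define E where "E = (\<Sum>i\<in>UNIV. \<Sum>j\<in>UNIV. gi i j x * apply2 (H (U x)) (du i x) (ddu k j x))"
  have "(\<Sum>i\<in>UNIV. \<Sum>j\<in>UNIV. gi i j x * apply2 (H (U x)) (du j x) (ddu i k x)) = E"
    unfolding E_def by (subst sum.swap, intro sum.cong refl) (simp add: gi_commute[OF x] ddu_commute[of _ k])
  then have "divergence2 G pull k x = apply2 (H (U x)) (tension_comp G H U x) (du k x) + E"
    by (simp add: divergence2_def nabla2_pull distrib_left sum.distrib tension_eq apply2_bilinear)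
  moreover have "(\<Sum>i\<in>UNIV. \<Sum>j\<in>UNIV. gi i j x * apply2 (H (U x)) (ddu k i x) (du j x)) = E"
    unfolding E_def
  proof (subst sum.swap, intro sum.cong refl)
    fix i j
    show "gi j i x * apply2 (H (U x)) (ddu k j x) (du i x) = gi i j x * apply2 (H (U x)) (du i x) (ddu k j x)"
      using gi_commute[OF x] apply2_H_commute by metis
  qed
  then have "partial k (trace2 G pull) x = E + E"
    by (simp add: partial_trace2[OF x smooth_pull] nabla2_pull distrib_left sum.distrib E_def)
  ultimately show ?thesis by simp
qed

end

end

section \<open>The soliton equations in coordinates\<close>

text \<open>\<open>Sc\<close> is a parameter tied to \<open>pull\<close> on \<open>W\<close> only:
  \<open>Sc_tensor\<close> lives on the whole source chart, while \<open>pull\<close> is computed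
  with one target chart. \<open>tension\<close> is the second soliton equation in target
  components.\<close>

locale soliton_coordinates = map_coordinates W G V H U
  for W :: "(real^'m::finite) set" and G :: "'m field2"
    and V :: "(real^'n::finite) set" and H :: "'n field2" and U :: "real^'m \<Rightarrow> real^'n" +
  fixes \<alpha> :: real and F s :: "real^'m \<Rightarrow> real" and Sc :: "'m field2"
  assumes smooth_F: "smooth_on W F" and smooth_s: "smooth_on W s"
    and Sc_eq: "\<And>y. y \<in> W \<Longrightarrow> Sc y = ricci G y - \<alpha> *\<^sub>R pull y"
    and soliton: "\<And>y. y \<in> W \<Longrightarrow> Sc y + hessian G F y = s y *\<^sub>R G y"
    and tension: "\<And>y. y \<in> W \<Longrightarrow> tension_comp G H U y = (\<Sum>i\<in>UNIV. gradient G F y $ i *\<^sub>R du i y)"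
begin

lemma smooth_Sc: "smooth_on W (\<lambda>y. Sc y $ i $ j)"
proof (subst smooth_on_cong[OF open_W])
  show "Sc y $ i $ j = ricci G y $ i $ j - \<alpha> * pull y $ i $ j" if "y \<in> W" for y
    by (simp add: Sc_eq[OF that])
  show "smooth_on W (\<lambda>y. ricci G y $ i $ j - \<alpha> * pull y $ i $ j)"
    by (intro smooth_on_diff smooth_on_mult smooth_on_const open_W smooth_ricci smooth_pull)
qed

abbreviation "S \<equiv> trace2 G Sc"

abbreviation "grad_sq \<equiv> \<lambda>y. apply2 (G y) (gradient G F y) (gradient G F y)"

lemma smooth_S: "smooth_on W S"
  by (rule smooth_trace2[OF smooth_Sc])

lemma smooth_grad_sq: "smooth_on W grad_sq"
  by (subst smooth_on_cong[OF open_W apply2_gradients'])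
    (auto intro!: smooth_on_sum open_W smooth_on_mult smooth_gi smooth_on_partial smooth_F)

lemma trace_metric: "y \<in> W \<Longrightarrow> (\<Sum>i\<in>UNIV. \<Sum>j\<in>UNIV. gi i j y * G y $ i $ j) = real CARD('m)"
proof -
  assume y: "y \<in> W"
  have "(\<Sum>i\<in>UNIV. \<Sum>j\<in>UNIV. gi i j y * G y $ i $ j) = (\<Sum>i\<in>UNIV. \<Sum>j\<in>UNIV. gi i j y * G y $ j $ i)"
    by (intro sum.cong refl arg_cong2[of _ _ _ _ "(*)"] sym_G[OF y])
  then show ?thesis by (simp add: sum_gi_G[OF y])
qed

lemma laplacian_F: "y \<in> W \<Longrightarrow> laplacian G F y = real CARD('m) * s y - S y"
proof -
  assume y: "y \<in> W"
  have "hessian G F y $ i $ j = s y * G y $ i $ j - Sc y $ i $ j" for i j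
    using arg_cong[OF soliton[OF y], of "\<lambda>M. M $ i $ j"] by (simp add: algebra_simps)
  then have "laplacian G F y = s y * (\<Sum>i\<in>UNIV. \<Sum>j\<in>UNIV. gi i j y * G y $ i $ j) - S y"
    by (simp add: laplacian_def trace2_def right_diff_distrib sum_subtractf sum_distrib_left mult_ac)
  then show ?thesis by (simp add: trace_metric[OF y])
qed

context
  fixes x assumes x: "x \<in> W"
begin

abbreviation (input) "gF \<equiv> gradient G F x"

lemma Sc_commute: "Sc x $ i $ j = Sc x $ j $ i"
  by (simp add: Sc_eq[OF x] ricci_commute[OF x, of i j] pull_commute[OF x, of i j])

lemma divergence_Sc:
  "divergence2 G Sc k x = 1/2 * partial k S x - \<alpha> * apply2 (H (U x)) (tension_comp G H U x) (du k x)"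
proof -
  have dSc: "partial i (\<lambda>y. Sc y $ j $ k) x = partial i (\<lambda>y. ricci G y $ j $ k) x - \<alpha> * partial i (\<lambda>y. pull y $ j $ k) x" for i j k
  proof -
    have "partial i (\<lambda>y. Sc y $ j $ k) x = partial i (\<lambda>y. ricci G y $ j $ k - \<alpha> * pull y $ j $ k) x"
      by (rule partial_cong[OF open_W x]) (simp add: Sc_eq)
    also have "\<dots> = partial i (\<lambda>y. ricci G y $ j $ k) x - partial i (\<lambda>y. \<alpha> * pull y $ j $ k) x"
      by (intro partial_diff differentiable[OF _ x] smooth_on_mult open_W smooth_on_const smooth_ricci smooth_pull)
    also have "partial i (\<lambda>y. \<alpha> * pull y $ j $ k) x = \<alpha> * partial i (\<lambda>y. pull y $ j $ k) x"
      by (intro partial_cmult differentiable[OF _ x] smooth_pull)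
    finally show ?thesis .
  qed
  have n: "nabla2 G Sc i j k x = nabla2 G (ricci G) i j k x - \<alpha> * nabla2 G pull i j k x" for i j k
    by (simp add: nabla2_def dSc Sc_eq[OF x] right_diff_distrib sum_subtractf sum_distrib_left mult.left_commute)
  have "divergence2 G Sc k x = divergence2 G (ricci G) k x - \<alpha> * divergence2 G pull k x"
    by (simp add: divergence2_def n right_diff_distrib sum_subtractf sum_distrib_left mult.left_commute)
  moreover have "partial k S x = partial k (trace2 G (ricci G)) x - \<alpha> * partial k (trace2 G pull) x"
    by (simp add: partial_trace2[OF x] smooth_Sc smooth_ricci smooth_pull n right_diff_distrib
        sum_subtractf sum_distrib_left mult.left_commute)
  ultimately show ?thesis
    by (simp add: divergence_ricci[OF x] divergence_pull[OF x] algebra_simps)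
qed

lemma hessian_F: "hessian G F x $ i $ j = s x * G x $ i $ j - Sc x $ i $ j"
  using arg_cong[OF soliton[OF x], of "\<lambda>M. M $ i $ j"] by (simp add: algebra_simps)

text \<open>The Hessian is s G - Sc, and since \<open>G\<close> is parallel the divergence of s G is
  the differential of \<open>s\<close>.\<close>

lemma divergence_hessian_F: "divergence2 G (hessian G F) k x = partial k s x - divergence2 G Sc k x"
proof -
  have dH: "partial i (\<lambda>y. hessian G F y $ j $ k) x = partial i s x * G x $ j $ k
      + s x * partial i (\<lambda>y. G y $ j $ k) x - partial i (\<lambda>y. Sc y $ j $ k) x" for i j k
  proof -
    have "partial i (\<lambda>y. hessian G F y $ j $ k) x = partial i (\<lambda>y. s y * G y $ j $ k - Sc y $ j $ k) x"
    proof (rule partial_cong[OF open_W x])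
      fix y assume "y \<in> W"
      then show "hessian G F y $ j $ k = s y * G y $ j $ k - Sc y $ j $ k"
        using arg_cong[OF soliton, of y "\<lambda>M. M $ j $ k"] by (simp add: algebra_simps)
    qed
    also have "\<dots> = partial i (\<lambda>y. s y * G y $ j $ k) x - partial i (\<lambda>y. Sc y $ j $ k) x"
      by (intro partial_diff differentiable[OF _ x] smooth_on_mult open_W smooth_s smooth_G smooth_Sc)
    also have "partial i (\<lambda>y. s y * G y $ j $ k) x = partial i s x * G x $ j $ k + s x * partial i (\<lambda>y. G y $ j $ k) x"
      by (intro partial_mult differentiable[OF _ x] smooth_s smooth_G)
    finally show ?thesis .
  qed
  have n: "nabla2 G (hessian G F) i j k x = partial i s x * G x $ j $ k - nabla2 G Sc i j k x" for i j k
    by (simp add: nabla2_def dH hessian_F metric_compatible[OF x] right_diff_distrib sum_subtractf sum_distrib_left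
        distrib_left mult.left_commute)
  have "(\<Sum>i\<in>UNIV. \<Sum>j\<in>UNIV. gi i j x * (partial i s x * G x $ j $ k)) = (\<Sum>i\<in>UNIV. partial i s x * (\<Sum>j\<in>UNIV. gi i j x * G x $ j $ k))"
    by (simp add: sum_distrib_left mult.left_commute)
  also have "\<dots> = partial k s x"
    by (simp add: sum_gi_G[OF x] if_distrib cong: if_cong)
  finally show ?thesis
    by (simp add: divergence2_def n right_diff_distrib sum_subtractf)
qed

text \<open>Since the tension is du(grad f), pairing it with \<open>du\<close> is the pullback
  metric applied to grad f. This is the term that completes the Ricci tensor to
  \<open>Sc\<close>.\<close>

lemma tension_du: "apply2 (H (U x)) (tension_comp G H U x) (du k x) = (\<Sum>a\<in>UNIV. gF $ a * pull x $ a $ k)"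
  by (simp add: tension[OF x] apply2_bilinear pull_def)

text \<open>Two expressions for div Hess f are compared: m ds - dS + Rc(grad f) from the commutation
  formula, and ds - dS/2 + \<alpha> h(tau, du) from the soliton equation. Hence the coefficients 1/2
  and m - 1.\<close>

lemma Sc_gradient: "apply2 (Sc x) gF (axis k 1) = 1/2 * partial k S x - (real CARD('m) - 1) * partial k s x"
proof -
  have "partial k (laplacian G F) x = partial k (\<lambda>y. real CARD('m) * s y - S y) x"
    by (rule partial_cong[OF open_W x laplacian_F])
  also have "\<dots> = partial k (\<lambda>y. real CARD('m) * s y) x - partial k S x"
    by (intro partial_diff differentiable[OF _ x] smooth_on_mult open_W smooth_s smooth_on_const smooth_S)
  also have "partial k (\<lambda>y. real CARD('m) * s y) x = real CARD('m) * partial k s x"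
    by (intro partial_cmult differentiable[OF _ x] smooth_s)
  finally have l: "partial k (laplacian G F) x = real CARD('m) * partial k s x - partial k S x" .
  have "apply2 (Sc x) gF (axis k 1) = (\<Sum>a\<in>UNIV. ricci G x $ k $ a * gF $ a) - \<alpha> * (\<Sum>a\<in>UNIV. gF $ a * pull x $ a $ k)"
    by (simp add: apply2_axis Sc_eq[OF x] ricci_commute[OF x, of _ k] algebra_simps sum_subtractf sum_distrib_left)
  then show ?thesis
    using divergence_hessian[OF x smooth_F, of k] divergence_hessian_F[of k] divergence_Sc[of k] l
    by (simp add: tension_du algebra_simps)
qed

lemma apply2_expand: "apply2 T v w = (\<Sum>k\<in>UNIV. apply2 T v (axis k 1) * w $ k)"
  unfolding apply2_axis sum_distrib_right unfolding apply2_def by (rule sum.swap)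

lemma Sc_gradient_gradient:
  "apply2 (G x) (gradient G S x) gF = 2 * (real CARD('m) - 1) * apply2 (G x) (gradient G s x) gF + 2 * apply2 (Sc x) gF gF"
proof -
  have "apply2 (Sc x) gF gF = (\<Sum>k\<in>UNIV. (1/2 * partial k S x - (real CARD('m) - 1) * partial k s x) * gF $ k)"
    by (subst apply2_expand) (simp add: Sc_gradient)
  also have "\<dots> = 1/2 * (\<Sum>k\<in>UNIV. partial k S x * gF $ k) - (real CARD('m) - 1) * (\<Sum>k\<in>UNIV. partial k s x * gF $ k)"
    by (simp add: left_diff_distrib sum_subtractf sum_distrib_left mult.assoc)
  finally show ?thesis by (simp add: apply2_gradients[OF x] algebra_simps)
qed

text \<open>By the soliton equation the differential of |grad f|^2 is 2 s df - 2 Sc(grad f, .), and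
  \<open>Sc_gradient\<close> turns the last term into -dS + 2 (m - 1) ds, which cancels dS.\<close>

lemma gradient_S_grad_sq:
  "partial k (\<lambda>y. S y + grad_sq y) x = 2 * (real CARD('m) - 1) * partial k s x + 2 * s x * partial k F x"
proof -
  have "partial k (\<lambda>y. S y + grad_sq y) x = partial k S x + partial k grad_sq x"
    by (intro partial_add differentiable[OF _ x] smooth_S smooth_grad_sq)
  also have "partial k grad_sq x = 2 * (\<Sum>a\<in>UNIV. hessian G F x $ k $ a * gF $ a)"
    unfolding partial_norm_gradient[OF x smooth_F] by (simp add: gradient_def sum_distrib_left mult.left_commute)
  also have "(\<Sum>a\<in>UNIV. hessian G F x $ k $ a * gF $ a) = s x * partial k F x - apply2 (Sc x) gF (axis k 1)"
    by (simp add: hessian_F apply2_axis Sc_commute[of _ k] left_diff_distrib sum_subtractf mult.assoc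
        sum_distrib_left[symmetric] gradient_lower[OF x])
  finally show ?thesis by (simp add: Sc_gradient algebra_simps)
qed

text \<open>Pairing div Hess f with grad f yields one inner product of grad s and grad f; replacing
  half the inner product of grad S and grad f by \<open>Sc_gradient_gradient\<close> subtracts m - 1
  of them, which leaves the factor -(m - 2).\<close>

lemma bochner:
  "1/2 * laplacian G grad_sq x = norm2_squared G (hessian G F) x
     - (real CARD('m) - 2) * apply2 (G x) (gradient G s x) gF - apply2 (Sc x) gF gF + \<alpha> * apply2 (pull x) gF gF"
proof -
  have "apply2 (pull x) gF gF = (\<Sum>k\<in>UNIV. apply2 (H (U x)) (tension_comp G H U x) (du k x) * gF $ k)"
    by (subst apply2_expand) (simp add: tension_du apply2_axis mult.commute)
  moreover have "(\<Sum>k\<in>UNIV. divergence2 G (hessian G F) k x * gF $ k)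
     = (\<Sum>k\<in>UNIV. partial k s x * gF $ k) - 1/2 * (\<Sum>k\<in>UNIV. partial k S x * gF $ k)
       + \<alpha> * (\<Sum>k\<in>UNIV. apply2 (H (U x)) (tension_comp G H U x) (du k x) * gF $ k)"
    by (simp add: divergence_hessian_F divergence_Sc algebra_simps sum.distrib sum_subtractf sum_distrib_left)
  ultimately show ?thesis
    using Sc_gradient_gradient laplacian_norm_gradient[OF x smooth_F]
    by (simp add: apply2_gradients[OF x] algebra_simps)
qed

end
end

section \<open>Charts and tangent vectors\<close>

lemma chart_inverse:
  assumes "is_chart c"
  shows "p \<in> chart_dom c \<Longrightarrow> chart_inv c (chart_map c p) = p"
    and "x \<in> chart_img c \<Longrightarrow> chart_map c (chart_inv c x) = x"
    and "x \<in> chart_img c \<Longrightarrow> chart_inv c x \<in> chart_dom c"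
    and "p \<in> chart_dom c \<Longrightarrow> chart_map c p \<in> chart_img c"
  using assms by (auto simp: is_chart_def homeomorphism_def)

lemma chart_image_iff:
  assumes "is_chart c"
  shows "x \<in> chart_map c ` (chart_dom c \<inter> W) \<longleftrightarrow> x \<in> chart_img c \<and> chart_inv c x \<in> W"
proof
  assume "x \<in> chart_img c \<and> chart_inv c x \<in> W"
  then show "x \<in> chart_map c ` (chart_dom c \<inter> W)"
    using chart_inverse(2,3)[OF assms] by (intro image_eqI[of _ _ "chart_inv c x"]) simp_all
qed (use chart_inverse(1,4)[OF assms] in auto)

lemma open_chart_image:
  assumes "is_chart c" "open W"
  shows "open (chart_map c ` (chart_dom c \<inter> W))"
proof -
  have "open (chart_img c \<inter> chart_inv c -` W)"
    using assms by (auto simp: is_chart_def homeomorphism_def intro!: continuous_open_preimage)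
  moreover have "chart_map c ` (chart_dom c \<inter> W) = chart_img c \<inter> chart_inv c -` W"
    using chart_image_iff[OF assms(1)] by auto
  ultimately show ?thesis by simp
qed

lemma smooth_fun_on_subset: "smooth_fun_on A W F \<Longrightarrow> V \<subseteq> W \<Longrightarrow> smooth_fun_on A V F"
  unfolding smooth_fun_on_def by (meson smooth_on_subset image_mono Int_mono order_refl)

lemma smooth_near_common:
  assumes "smooth_near A p F" "smooth_near A p H"
  obtains W where "open W" "p \<in> W" "smooth_fun_on A W F" "smooth_fun_on A W H"
  using assms smooth_fun_on_subset unfolding smooth_near_def
  by (metis IntI Int_lower1 Int_lower2 open_Int)

lemma coord_vec_eq_vec_of: "coord_vec A c p i = vec_of A c p (axis i 1)"
  by (rule ext) (simp add: vec_of_def sum_axis_component)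

context
  fixes A :: "('a::topological_space, 'm::finite) chart set"
  assumes A: "smooth_atlas A"
begin

lemma atlas_chart: "c \<in> A \<Longrightarrow> is_chart c"
  using A by (simp add: smooth_atlas_def)

text \<open>Ensures that \<open>coord_vec\<close> does not take its default value 0 on sums and
  products when linearity and the Leibniz rule are checked.\<close>

lemma smooth_near_combination:
  assumes "smooth_near A p F" "smooth_near A p H"
  shows "smooth_near A p (\<lambda>q. a * F q + b * H q)" and "smooth_near A p (\<lambda>q. F q * H q)"
proof -
  obtain W where W: "open W" "p \<in> W" "smooth_fun_on A W F" "smooth_fun_on A W H"
    using smooth_near_common[OF assms] .
  have "smooth_fun_on A W (\<lambda>q. a * F q + b * H q)"
    using W by (auto simp: smooth_fun_on_def o_def
        intro!: smooth_on_add smooth_on_mult smooth_on_const open_chart_image atlas_chart)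
  then show "smooth_near A p (\<lambda>q. a * F q + b * H q)" using W by (auto simp: smooth_near_def)
  have "smooth_fun_on A W (\<lambda>q. F q * H q)"
    using W by (auto simp: smooth_fun_on_def o_def intro!: smooth_on_mult open_chart_image atlas_chart)
  then show "smooth_near A p (\<lambda>q. F q * H q)" using W by (auto simp: smooth_near_def)
qed

lemma smooth_near_differentiable:
  assumes "smooth_near A p F" "c \<in> A" "p \<in> chart_dom c"
  shows "(\<lambda>x. F (chart_inv c x)) differentiable (at (chart_map c p))"
  using assms unfolding smooth_near_def smooth_fun_on_def o_def
  by (meson IntI imageI smooth_on_differentiable)

lemma coord_vec_tangent:
  assumes c: "c \<in> A" "p \<in> chart_dom c"
  shows "coord_vec A c p i \<in> tangent_space A p"
proof -
  have "coord_vec A c p i (\<lambda>q. a * F q + b * H q) = a * coord_vec A c p i F + b * coord_vec A c p i H"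
    "coord_vec A c p i (\<lambda>q. F q * H q) = F p * coord_vec A c p i H + H p * coord_vec A c p i F"
    if "smooth_near A p F" "smooth_near A p H" for F H a b
    using smooth_near_differentiable[OF that(1) c] smooth_near_differentiable[OF that(2) c]
      smooth_near_combination[OF that] that chart_inverse(1)[OF atlas_chart c(2)] c
    by (simp_all add: coord_vec_def o_def partial_add partial_cmult partial_mult)
  then show ?thesis by (auto simp: tangent_space_def coord_vec_def)
qed

lemma tangent_space_combination:
  assumes "X \<in> tangent_space A p" "Y \<in> tangent_space A p"
  shows "(\<lambda>F. a * X F + b * Y F) \<in> tangent_space A p"
  using assms unfolding tangent_space_def by (auto simp: algebra_simps)

lemma tangent_space_sum:
  assumes "finite I" "\<And>i. i \<in> I \<Longrightarrow> X i \<in> tangent_space A p"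
  shows "(\<lambda>F. \<Sum>i\<in>I. a i * X i F) \<in> tangent_space A p"
  using assms
proof (induction I rule: finite_induct)
  case empty
  then show ?case by (simp add: tangent_space_def)
next
  case (insert i I)
  then have "(\<lambda>F. a i * X i F + 1 * (\<Sum>i\<in>I. a i * X i F)) \<in> tangent_space A p"
    by (intro tangent_space_combination) auto
  with insert.hyps show ?case by simp
qed

lemma vec_of_tangent: "c \<in> A \<Longrightarrow> p \<in> chart_dom c \<Longrightarrow> vec_of A c p v \<in> tangent_space A p"
  using tangent_space_sum[of UNIV "coord_vec A c p" p "\<lambda>i. v $ i"] coord_vec_tangent
  by (simp add: vec_of_def[abs_def])

text \<open>Coordinate functions recover the components. They are smooth near \<open>p\<close>
  because \<open>chart_map c\<close> is smooth in every chart of the atlas, which is the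
  compatibility of charts.\<close>

lemma vec_of_coordinate:
  assumes c: "c \<in> A" "p \<in> chart_dom c"
  shows "vec_of A c p v (\<lambda>q. chart_map c q $ a) = v $ a"
proof -
  have ch: "is_chart c" using atlas_chart c by simp
  have "smooth_fun_on A (chart_dom c) (\<lambda>q. chart_map c q $ a)"
    using A c by (auto simp: smooth_atlas_def smooth_fun_on_def o_def)
  moreover have "open (chart_dom c)" using ch by (simp add: is_chart_def)
  ultimately have near: "smooth_near A p (\<lambda>q. chart_map c q $ a)"
    using c by (auto simp: smooth_near_def)
  have coord: "coord_vec A c p i (\<lambda>q. chart_map c q $ a) = (if i = a then 1 else 0)" for i
  proof -
    have "partial i (\<lambda>x. chart_map c (chart_inv c x) $ a) (chart_map c p) = partial i (\<lambda>x. x $ a) (chart_map c p)"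
      by (rule partial_cong[of "chart_img c"]) (use ch c chart_inverse[OF ch] in \<open>auto simp: is_chart_def\<close>)
    with near show ?thesis by (simp add: coord_vec_def o_def)
  qed
  show ?thesis by (simp add: vec_of_def coord if_distrib cong: if_cong)
qed

text \<open>Turns equations between derivations into equations between components, for nondegeneracy
  of the metric matrix and for the tension equation.\<close>

lemma vec_of_inject:
  assumes "c \<in> A" "p \<in> chart_dom c" "vec_of A c p v = vec_of A c p w"
  shows "v = w"
  using vec_of_coordinate[OF assms(1,2)] assms(3) by (metis vec_eq_iff)

section \<open>The metric on coordinate vectors\<close>

context
  fixes g :: "'a tensor2"
  assumes g: "riemannian_metric A g"
begin

lemma metric_add_left:
  assumes "X \<in> tangent_space A p" "Y \<in> tangent_space A p" "Z \<in> tangent_space A p"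
  shows "g p (\<lambda>F. a * X F + b * Y F) Z = a * g p X Z + b * g p Y Z"
  using g assms by (simp add: riemannian_metric_def)

lemma metric_commute:
  assumes "X \<in> tangent_space A p" "Y \<in> tangent_space A p"
  shows "g p X Y = g p Y X"
  using g assms by (auto simp: riemannian_metric_def)

lemma metric_sum_left:
  assumes "finite I" "\<And>i. i \<in> I \<Longrightarrow> X i \<in> tangent_space A p" "Z \<in> tangent_space A p"
  shows "g p (\<lambda>F. \<Sum>i\<in>I. a i * X i F) Z = (\<Sum>i\<in>I. a i * g p (X i) Z)"
  using assms
proof (induction I rule: finite_induct)
  case empty
  \<comment> \<open>The zero vector is the combination of \<open>Z\<close> with itself with both
    coefficients 0.\<close>
  then show ?case using metric_add_left[of Z p Z Z 0 0] by simp
next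
  case (insert i I)
  then have "g p (\<lambda>F. a i * X i F + 1 * (\<Sum>i\<in>I. a i * X i F)) Z = a i * g p (X i) Z + 1 * g p (\<lambda>F. \<Sum>i\<in>I. a i * X i F) Z"
    by (intro metric_add_left tangent_space_sum) auto
  with insert show ?case by simp
qed

lemma metric_vec_of:
  assumes c: "c \<in> A" "x \<in> chart_img c"
  defines "p \<equiv> chart_inv c x"
  shows "g p (vec_of A c p v) (vec_of A c p w) = apply2 (tensor_components A g c x) v w"
proof -
  have p: "p \<in> chart_dom c" using chart_inverse(3)[OF atlas_chart] c by (simp add: p_def)
  note T = coord_vec_tangent[OF c(1) p] vec_of_tangent[OF c(1) p]
  have l: "g p (vec_of A c p v) Z = (\<Sum>i\<in>UNIV. v $ i * g p (coord_vec A c p i) Z)" if "Z \<in> tangent_space A p" for v Z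
    using metric_sum_left[of UNIV "coord_vec A c p" p Z "\<lambda>i. v $ i"] T that by (simp add: vec_of_def[abs_def])
  have r: "g p (coord_vec A c p i) (vec_of A c p w) = (\<Sum>j\<in>UNIV. w $ j * g p (coord_vec A c p i) (coord_vec A c p j))" for i
    by (simp add: metric_commute[OF T(1)[of i] T(2)] l[OF T(1)] metric_commute[OF T(1) T(1)[of i]])
  show ?thesis
    by (simp add: l[OF T(2)] r apply2_def tensor_components_def p_def[symmetric] sum_distrib_left mult_ac)
qed

lemma metric_coordinates_chart:
  assumes c: "c \<in> A" and W: "open W" "W \<subseteq> chart_img c"
  shows "metric_coordinates W (tensor_components A g c)"
proof
  show "open W" by fact
  show "smooth_on W (\<lambda>x. tensor_components A g c x $ i $ j)" for i j
  proof (rule smooth_on_subset[OF _ W(2)])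
    show "smooth_on (chart_img c) (\<lambda>x. tensor_components A g c x $ i $ j)"
      using g c unfolding riemannian_metric_def by blast
  qed
  fix x assume "x \<in> W"
  then have x: "x \<in> chart_img c" using W by auto
  let ?G = "tensor_components A g c x" and ?p = "chart_inv c x"
  have p: "?p \<in> chart_dom c" using chart_inverse(3)[OF atlas_chart] c x by simp
  show "?G $ i $ j = ?G $ j $ i" for i j
    unfolding tensor_components_def
    by (simp, rule metric_commute) (rule coord_vec_tangent[OF c p])+
  \<comment> \<open>A kernel vector of the matrix has length 0, so positivity makes its derivation
    zero, and injectivity makes its components zero.\<close>
  have "v = 0" if "?G *v v = 0" for v
  proof -
    have "g ?p (vec_of A c ?p v) (vec_of A c ?p v) = 0"
      using metric_vec_of[OF c x] that by (simp add: apply2_inner)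
    then have "vec_of A c ?p v = (\<lambda>F. 0)"
      using g vec_of_tangent[OF c p] unfolding riemannian_metric_def by (metis less_irrefl)
    then have "vec_of A c ?p v = vec_of A c ?p 0" by (simp add: vec_of_def[abs_def])
    then show ?thesis by (rule vec_of_inject[OF c p])
  qed
  then show "invertible ?G" by (simp add: invertible_left_inverse matrix_left_invertible_ker)
qed

end

end

section \<open>Smooth maps in charts\<close>

context
  fixes A :: "('a::topological_space, 'm::finite) chart set"
    and B :: "('b::topological_space, 'n::finite) chart set"
    and u :: "'a \<Rightarrow> 'b"
  assumes A: "smooth_atlas A" and B: "smooth_atlas B" and u: "smooth_map A B u"
begin

lemma open_vimage_map: "open V \<Longrightarrow> open (u -` V)"
  using u by (auto simp: smooth_map_def intro: open_vimage)

text \<open>Near each point F o u is, in coordinates, F in a target chart composed with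
  \<open>u\<close> in charts. The result guarantees that \<open>differential\<close> applies a
  tangent vector to a function on which it is not 0 by default.\<close>

lemma smooth_near_compose:
  assumes "smooth_near B (u p) F"
  shows "smooth_near A p (\<lambda>q. F (u q))"
proof -
  obtain V where V: "open V" "u p \<in> V" "smooth_fun_on B V F"
    using assms by (auto simp: smooth_near_def)
  have "smooth_fun_on A (u -` V) (\<lambda>q. F (u q))"
    unfolding smooth_fun_on_def o_def
  proof (intro ballI smooth_on_local)
    fix c x assume c: "c \<in> A" and "x \<in> chart_map c ` (chart_dom c \<inter> u -` V)"
    then have x: "x \<in> chart_img c" "u (chart_inv c x) \<in> V"
      using chart_image_iff[OF atlas_chart[OF A c]] by auto
    obtain d where d: "d \<in> B" "u (chart_inv c x) \<in> chart_dom d"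
      using B unfolding smooth_atlas_def by (metis UNIV_I UN_E)
    note ch = atlas_chart[OF A c] and dh = atlas_chart[OF B d(1)]
    let ?W = "chart_map c ` (chart_dom c \<inter> (u -` (V \<inter> chart_dom d)))"
    let ?V = "chart_map d ` (chart_dom d \<inter> V)"
    let ?U = "\<lambda>y. chart_map d (u (chart_inv c y))"
    have W: "open ?W"
      using dh V(1) by (intro open_chart_image ch open_vimage_map open_Int) (auto simp: is_chart_def)
    have smU: "smooth_on ?W (\<lambda>y. ?U y $ a)" for a
    proof (rule smooth_on_subset)
      show "smooth_on (chart_map c ` (chart_dom c \<inter> u -` chart_dom d)) (\<lambda>y. ?U y $ a)"
        using u c d(1) unfolding smooth_map_def by blast
    qed auto
    have in_V: "?U ` ?W \<subseteq> ?V"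
    proof (rule image_subsetI)
      fix y assume "y \<in> ?W"
      then have "u (chart_inv c y) \<in> chart_dom d \<inter> V" unfolding chart_image_iff[OF ch] by simp
      then show "?U y \<in> ?V" by (rule imageI)
    qed
    have "smooth_on ?V (\<lambda>z. F (chart_inv d z))"
      using V(3) d(1) by (auto simp: smooth_fun_on_def o_def)
    then have "smooth_on ?W (\<lambda>y. F (chart_inv d (?U y)))"
      by (rule smooth_on_compose[OF W open_chart_image[OF dh V(1)] in_V _ smU])
    moreover have "F (chart_inv d (?U y)) = F (u (chart_inv c y))" if "y \<in> ?W" for y
      using that chart_inverse(1)[OF dh] unfolding chart_image_iff[OF ch] by simp
    ultimately have "smooth_on ?W (\<lambda>y. F (u (chart_inv c y)))"
      using smooth_on_cong[OF W] by (metis (no_types, lifting))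
    moreover have "x \<in> ?W" using x d unfolding chart_image_iff[OF ch] by simp
    ultimately show "\<exists>W. open W \<and> x \<in> W \<and> smooth_on W (\<lambda>y. F (u (chart_inv c y)))"
      using W by blast
  qed
  then show ?thesis using V open_vimage_map unfolding smooth_near_def by (metis vimageI2)
qed

end

text \<open>One source chart and one target chart; \<open>W\<close> below consists of the
  coordinates of the points of the former that \<open>u\<close> sends into the latter, and may be
  empty.\<close>

locale charts_of_map =
  fixes A :: "('a::topological_space, 'm::finite) chart set"
    and B :: "('b::topological_space, 'n::finite) chart set"
    and u :: "'a \<Rightarrow> 'b" and g :: "'a tensor2" and h :: "'b tensor2" and c d
  assumes A: "smooth_atlas A" and B: "smooth_atlas B" and u: "smooth_map A B u"
    and g: "riemannian_metric A g" and h: "riemannian_metric B h"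
    and c: "c \<in> A" and d: "d \<in> B"
begin

abbreviation "W \<equiv> chart_map c ` (chart_dom c \<inter> u -` chart_dom d)"

abbreviation "U \<equiv> \<lambda>y. chart_map d (u (chart_inv c y))"

abbreviation "G \<equiv> tensor_components A g c"

abbreviation "H \<equiv> tensor_components B h d"

lemma open_overlap: "open W"
  using atlas_chart[OF B d] by (intro open_chart_image atlas_chart[OF A c] open_vimage_map[OF A B u]) (simp add: is_chart_def)

lemma smooth_on_U: "smooth_on W (\<lambda>y. U y $ a)"
  using u c d unfolding smooth_map_def by blast

text \<open>The Jacobian in charts represents the differential: the chain rule is applied to F o
  d^-1 composed with the local representation \<open>U\<close>.\<close>

lemma differential_vec_of:
  assumes x: "x \<in> W"
  defines "p \<equiv> chart_inv c x"
  shows "differential B u p (vec_of A c p v)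
    = vec_of B d (u p) (\<Sum>i\<in>UNIV. v $ i *\<^sub>R (\<chi> a. partial i (\<lambda>y. U y $ a) x))"
proof
  fix F
  note ch = atlas_chart[OF A c] and dh = atlas_chart[OF B d]
  have p: "p \<in> chart_dom c" "u p \<in> chart_dom d" "chart_map c p = x"
    using x chart_inverse(2,3)[OF ch, of x] unfolding chart_image_iff[OF ch] p_def by auto
  show "differential B u p (vec_of A c p v) F
    = vec_of B d (u p) (\<Sum>i\<in>UNIV. v $ i *\<^sub>R (\<chi> a. partial i (\<lambda>y. U y $ a) x)) F"
  proof (cases "smooth_near B (u p) F")
    case True
    have "partial i (\<lambda>y. F (u (chart_inv c y))) x
      = (\<Sum>a\<in>UNIV. partial i (\<lambda>y. U y $ a) x * coord_vec B d (u p) a F)" for i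
    proof -
      have "partial i (\<lambda>y. F (u (chart_inv c y))) x = partial i (\<lambda>y. F (chart_inv d (U y))) x"
      proof (rule partial_cong[OF open_overlap x])
        fix y assume "y \<in> W"
        then show "F (u (chart_inv c y)) = F (chart_inv d (U y))"
          using chart_inverse(1)[OF dh] unfolding chart_image_iff[OF ch] by simp
      qed
      also have "\<dots> = (\<Sum>a\<in>UNIV. partial i (\<lambda>y. U y $ a) x * partial a (\<lambda>z. F (chart_inv d z)) (U x))"
        using smooth_near_differentiable[OF B True d p(2)] smooth_on_differentiable[OF smooth_on_U x]
        by (intro compose_derivative(2)[where F = "\<lambda>z. F (chart_inv d z)"]) (simp_all add: p_def)
      finally show ?thesis using True by (simp add: coord_vec_def o_def p_def)
    qed
    then have "differential B u p (vec_of A c p v) F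
      = (\<Sum>i\<in>UNIV. \<Sum>a\<in>UNIV. v $ i * partial i (\<lambda>y. U y $ a) x * coord_vec B d (u p) a F)"
      using True smooth_near_compose[OF A B u True] p
      by (simp add: differential_def vec_of_def coord_vec_def[of A] o_def sum_distrib_left mult.assoc)
    also have "\<dots> = (\<Sum>a\<in>UNIV. \<Sum>i\<in>UNIV. v $ i * partial i (\<lambda>y. U y $ a) x * coord_vec B d (u p) a F)"
      by (rule sum.swap)
    finally show ?thesis by (simp add: vec_of_def sum_distrib_right)
  \<comment> \<open>For \<open>F\<close> not smooth near the image point both sides are 0 by
    convention.\<close>
  qed (simp add: differential_def vec_of_def coord_vec_def)
qed

sublocale map_coordinates W G "chart_img d" H U
proof -
  have "W \<subseteq> chart_img c" by (auto simp: chart_img_def)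
  then interpret metric_coordinates W G
    by (rule metric_coordinates_chart[OF A g c open_overlap])
  have "open (chart_img d)" using atlas_chart[OF B d] by (simp add: is_chart_def)
  then interpret tgt: metric_coordinates "chart_img d" H
    by (rule metric_coordinates_chart[OF B h d _ order_refl])
  show "map_coordinates W G (chart_img d) H U"
    by unfold_locales (auto intro!: smooth_on_U simp: chart_img_def chart_inverse(1)[OF atlas_chart[OF A c]])
qed

context
  fixes x assumes x: "x \<in> W"
begin

abbreviation "p \<equiv> chart_inv c x"

lemma target_point: "u p \<in> chart_dom d" "chart_inv d (U x) = u p" "U x \<in> chart_img d"
  using x chart_inverse[OF atlas_chart[OF B d]] unfolding chart_image_iff[OF atlas_chart[OF A c]] by auto

lemma differential_du:
  "differential B u p (vec_of A c p v) = vec_of B d (u p) (\<Sum>i\<in>UNIV. v $ i *\<^sub>R du i x)"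
  unfolding differential_vec_of[OF x] du_def ..

lemma differential_coord_vec: "differential B u p (coord_vec A c p i) = vec_of B d (u p) (du i x)"
proof -
  have "(\<Sum>j\<in>UNIV. axis i 1 $ j *\<^sub>R du j x) = du i x"
    by (simp add: vec_eq_iff sum_axis_component)
  then show ?thesis by (simp add: coord_vec_eq_vec_of differential_du)
qed

lemma metric_target: "h (u p) (vec_of B d (u p) v) (vec_of B d (u p) w) = apply2 (H (U x)) v w"
  using metric_vec_of[OF B h d target_point(3), unfolded target_point(2)] .

lemma tensor_components_pullback: "tensor_components A (pullback B h u) c x = pull x"
  by (simp add: vec_eq_iff tensor_components_def pullback_def pull_def differential_coord_vec
      metric_target[unfolded tensor_components_def])

lemma pullback_vec_of: "pullback B h u p (vec_of A c p v) (vec_of A c p w) = apply2 (pull x) v w"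
proof -
  have "pullback B h u p (vec_of A c p v) (vec_of A c p w)
    = apply2 (H (U x)) (\<Sum>i\<in>UNIV. v $ i *\<^sub>R du i x) (\<Sum>i\<in>UNIV. w $ i *\<^sub>R du i x)"
    by (simp add: pullback_def differential_du metric_target)
  also have "\<dots> = (\<Sum>j\<in>UNIV. \<Sum>i\<in>UNIV. pull x $ i $ j * v $ i * w $ j)"
    by (simp add: apply2_bilinear pull_def sum_distrib_left mult_ac)
  also have "\<dots> = apply2 (pull x) v w"
    unfolding apply2_def by (rule sum.swap)
  finally show ?thesis .
qed

end

text \<open>The tensor equation is already in components. The tension equation equates two tangent
  vectors of the target, and its components follow from \<open>differential_du\<close> and
  injectivity of \<open>vec_of\<close>.\<close>

lemma soliton_coordinates_charts:
  assumes "gradient_almost_RH_soliton \<alpha> A B h g u f \<sigma>"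
  shows "soliton_coordinates W G (chart_img d) H U \<alpha> (f \<circ> chart_inv c) (\<sigma> \<circ> chart_inv c) (Sc_tensor \<alpha> A g B h u c)"
proof unfold_locales
  have img: "W \<subseteq> chart_img c" by (auto simp: chart_img_def)
  have "smooth_on W (F \<circ> chart_inv c)" if "smooth_fun_on A UNIV F" for F
    using that c smooth_on_subset[OF _ img] by (auto simp: smooth_fun_on_def chart_img_def)
  then show "smooth_on W (f \<circ> chart_inv c)" "smooth_on W (\<sigma> \<circ> chart_inv c)"
    using assms by (auto simp: gradient_almost_RH_soliton_def)
  fix y assume y: "y \<in> W"
  then have y_img: "y \<in> chart_img c" using img by auto
  show "Sc_tensor \<alpha> A g B h u c y = ricci G y - \<alpha> *\<^sub>R pull y"
    by (simp add: Sc_tensor_def tensor_components_pullback[OF y])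
  show "Sc_tensor \<alpha> A g B h u c y + hessian G (f \<circ> chart_inv c) y = (\<sigma> \<circ> chart_inv c) y *\<^sub>R G y"
    using assms c y_img by (simp add: gradient_almost_RH_soliton_def)
  let ?q = "chart_inv c y"
  have "tension A g B h u c d y F - differential B u ?q (grad_vec A g f c y) F = 0" for F
    using assms c d y_img target_point(1)[OF y] unfolding gradient_almost_RH_soliton_def by blast
  then have "vec_of B d (u ?q) (tension_comp G H U y)
      = vec_of B d (u ?q) (\<Sum>i\<in>UNIV. gradient G (f \<circ> chart_inv c) y $ i *\<^sub>R du i y)"
    by (intro ext) (simp add: tension_def grad_vec_def differential_du[OF y] o_def)
  then show "tension_comp G H U y = (\<Sum>i\<in>UNIV. gradient G (f \<circ> chart_inv c) y $ i *\<^sub>R du i y)"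
    by (rule vec_of_inject[OF B d target_point(1)[OF y]])
qed

end

theorem proposition3p1:
  fixes A :: "('a::{t2_space, second_countable_topology}, 'm::finite) chart set"
    and g :: "'a tensor2"
    and B :: "('b::{t2_space, second_countable_topology}, 'n::finite) chart set"
    and h :: "'b tensor2"
    and \<alpha> :: real and u :: "'a \<Rightarrow> 'b" and f \<sigma> :: "'a \<Rightarrow> real"
  assumes "riemannian_manifold A g" and "riemannian_manifold B h" and "\<alpha> > 0"
    and "gradient_almost_RH_soliton \<alpha> A B h g u f \<sigma>"
  shows "\<forall>c\<in>A. \<forall>x\<in>chart_img c.
    (let p = chart_inv c x;
         m = real CARD('m);
         G = tensor_components A g c;
         Sc = Sc_tensor \<alpha> A g B h u c;
         S = trace2 G Sc;
         fc = f \<circ> chart_inv c;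
         \<sigma>c = \<sigma> \<circ> chart_inv c;
         grad = gradient G;
         grad_f_sq = (\<lambda>y. apply2 (G y) (grad fc y) (grad fc y))
     in
      (\<forall>d\<in>B. u p \<in> chart_dom d \<longrightarrow>
         (\<forall>k. divergence2 G Sc k x = 1/2 * partial k S x
            - \<alpha> * h (u p) (tension A g B h u c d x) (differential B u p (coord_vec A c p k)))) \<and>
      apply2 (G x) (grad S x) (grad fc x)
        = 2 * (m - 1) * apply2 (G x) (grad \<sigma>c x) (grad fc x)
          + 2 * apply2 (Sc x) (grad fc x) (grad fc x) \<and>
      (\<forall>k. apply2 (Sc x) (grad fc x) (axis k 1)
         = 1/2 * partial k S x - (m - 1) * partial k \<sigma>c x) \<and>
      (\<forall>k. partial k (\<lambda>y. S y + grad_f_sq y) x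
         = 2 * (m - 1) * partial k \<sigma>c x + 2 * \<sigma>c x * partial k fc x) \<and>
      1/2 * laplacian G grad_f_sq x
        = norm2_squared G (hessian G fc) x
          - (m - 2) * apply2 (G x) (grad \<sigma>c x) (grad fc x)
          - apply2 (Sc x) (grad fc x) (grad fc x)
          + \<alpha> * pullback B h u p (grad_vec A g f c x) (grad_vec A g f c x))"
proof (intro ballI, goal_cases)
  case (1 c x)
  then have c: "c \<in> A" and x: "x \<in> chart_img c" .
  from assms have A: "smooth_atlas A" and g: "riemannian_metric A g"
    and B: "smooth_atlas B" and h: "riemannian_metric B h"
    by (simp_all add: riemannian_manifold_def)
  have u: "smooth_map A B u" using assms by (simp add: gradient_almost_RH_soliton_def)
  have charts: "charts_of_map A B u g h c d" if "d \<in> B" for d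
    by (rule charts_of_map.intro) fact+
  have x_W: "x \<in> chart_map c ` (chart_dom c \<inter> u -` chart_dom d)" if "u (chart_inv c x) \<in> chart_dom d" for d
    using x that unfolding chart_image_iff[OF atlas_chart[OF A c]] by simp
  note soliton = charts_of_map.soliton_coordinates_charts[OF charts assms(4)]
  have divergence: "divergence2 (tensor_components A g c) (Sc_tensor \<alpha> A g B h u c) k x
      = 1/2 * partial k (trace2 (tensor_components A g c) (Sc_tensor \<alpha> A g B h u c)) x
        - \<alpha> * h (u (chart_inv c x)) (tension A g B h u c d x)
            (differential B u (chart_inv c x) (coord_vec A c (chart_inv c x) k))"
    if d: "d \<in> B" "u (chart_inv c x) \<in> chart_dom d" for d k
    using soliton_coordinates.divergence_Sc[OF soliton[OF d(1)] x_W[OF d(2)]]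
    by (simp add: tension_def o_def charts_of_map.differential_coord_vec[OF charts[OF d(1)] x_W[OF d(2)]]
        charts_of_map.metric_target[OF charts[OF d(1)] x_W[OF d(2)]])
  \<comment> \<open>The other four equations name no target chart, but the computation takes place
    on an overlap with one; any chart around the image point serves.\<close>
  obtain d where d: "d \<in> B" "u (chart_inv c x) \<in> chart_dom d"
    using B unfolding smooth_atlas_def by (metis UNIV_I UN_E)
  note sol = soliton[OF d(1)] x_W[OF d(2)]
  show ?case
    unfolding Let_def grad_vec_def charts_of_map.pullback_vec_of[OF charts[OF d(1)] x_W[OF d(2)]]
    using divergence soliton_coordinates.Sc_gradient_gradient[OF sol] soliton_coordinates.Sc_gradient[OF sol]
      soliton_coordinates.gradient_S_grad_sq[OF sol] soliton_coordinates.bochner[OF sol]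
    by (intro conjI ballI impI allI) simp_all
qed

end
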